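(* Let $N\ge1$, $1<p<\infty$ and $0<s<1$ with $sp<N$, and let $p_s^*=\frac{Np}{N-sp}$. Let $\Omega\subset\mathbb{R}^N$ be a bounded Lipschitz domain. Then, for any $q\in[1,p_s^*]$, the following assertions hold: (i) The space $W^{s+\log,p}_0(\Omega)$ is continuously embedded into $L^q(\Omega)$. (ii) The embedding $W^{s+\log,p}_0(\Omega)\hookrightarrow L^q(\Omega)$ is compact.
   Context: $W^{s+\log,p}_0(\Omega)$ is the space of real-valued $u\in L^p(\mathbb{R}^N)$ with $u=0$ a.e. in $\mathbb{R}^N\setminus\Omega$ and finite norm $$\|u\|_{W^{s+\log,p}_0(\Omega)}:=\left(\iint_{\mathbb{R}^{2N}}|u(x)-u(y)|^p\,\mathbf{k}^{s+\log,+}_p(x-y)\,dx\,dy\right)^{1/p},\qquad\mathbf{k}^{s+\log,+}_p(z)=\frac{C(N,s,p)(-\ln|z|)_+}{|z|^{N+sp}},$$ where $(a)_+=\max\{0,a\}$ and $$C(N,s,p)=\begin{cases}\dfrac{s\,p\,2^{2(s-1)}\,\Gamma\left(\frac{N+sp}{2}\right)}{\pi^{\frac{N-1}{2}}\,\Gamma(1-s)\,\Gamma\left(\frac{p+1}{2}\right)}, & s>\tfrac12,\\[8pt]\dfrac{s\,p\,2^{2s-1}\,\Gamma\left(\frac{N+sp}{2}\right)}{\pi^{\frac N2}\,\Gamma(1-s)}, & s\le\tfrac12.\end{cases}$$ *)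

theory Defs
  imports "HOL-Analysis.Analysis"
begin

text \<open>
  Euclidean space \<open>\<real>\<^sup>N\<close> is a type \<open>'a :: euclidean_space\<close> with \<open>N = DIM('a)\<close>. The spaces below
  consist of functions rather than of classes modulo equality almost everywhere; accordingly
  their norms vanish exactly on the functions that are zero almost everywhere.
\<close>

definition Lp_space :: "'a measure \<Rightarrow> real \<Rightarrow> ('a \<Rightarrow> real) set" where
  "Lp_space M p = {u \<in> borel_measurable M. integrable M (\<lambda>x. \<bar>u x\<bar> powr p)}"

definition Lp_norm :: "'a measure \<Rightarrow> real \<Rightarrow> ('a \<Rightarrow> real) \<Rightarrow> real" where
  "Lp_norm M p u = (\<integral>x. \<bar>u x\<bar> powr p \<partial>M) powr (1 / p)"

definition frac_const :: "nat \<Rightarrow> real \<Rightarrow> real \<Rightarrow> real" where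
  "frac_const N s p =
     (if s > 1/2
      then s * p * 2 powr (2 * (s - 1)) * Gamma ((real N + s * p) / 2)
           / (pi powr ((real N - 1) / 2) * Gamma (1 - s) * Gamma ((p + 1) / 2))
      else s * p * 2 powr (2 * s - 1) * Gamma ((real N + s * p) / 2)
           / (pi powr (real N / 2) * Gamma (1 - s)))"

text \<open>At \<open>z = 0\<close> this is \<open>0\<close> by the conventions for \<open>ln\<close> and division; the diagonal is a null set.\<close>

definition log_kernel_plus :: "real \<Rightarrow> real \<Rightarrow> 'a::euclidean_space \<Rightarrow> real" where
  "log_kernel_plus s p z =
     frac_const DIM('a) s p * max 0 (- ln (norm z)) / norm z powr (real DIM('a) + s * p)"

definition slog_energy :: "real \<Rightarrow> real \<Rightarrow> ('a::euclidean_space \<Rightarrow> real) \<Rightarrow> ennreal" where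
  "slog_energy s p u =
     (\<integral>\<^sup>+ (x, y). ennreal (\<bar>u x - u y\<bar> powr p * log_kernel_plus s p (x - y))
        \<partial>(lebesgue :: ('a \<times> 'a) measure))"

definition slog_space :: "real \<Rightarrow> real \<Rightarrow> 'a::euclidean_space set \<Rightarrow> ('a \<Rightarrow> real) set" where
  "slog_space s p \<Omega> =
     {u \<in> Lp_space lebesgue p. (AE x in lebesgue. x \<notin> \<Omega> \<longrightarrow> u x = 0) \<and> slog_energy s p u < \<infinity>}"

definition slog_norm :: "real \<Rightarrow> real \<Rightarrow> ('a::euclidean_space \<Rightarrow> real) \<Rightarrow> real" where
  "slog_norm s p u = enn2real (slog_energy s p u) powr (1 / p)"

text \<open>
  Near each boundary point, \<open>\<Omega>\<close> is the part of a ball lying strictly above the graph of a Lipschitz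
  function \<open>g\<close>. Here \<open>e\<close> is the unit vector pointing upwards, and \<open>g\<close> is a function on the hyperplane
  orthogonal to \<open>e\<close>, which plays the role of \<open>\<real>\<^sup>N\<^sup>-\<^sup>1\<close>.
\<close>

definition lipschitz_domain :: "'a::euclidean_space set \<Rightarrow> bool" where
  "lipschitz_domain \<Omega> \<longleftrightarrow> \<Omega> \<noteq> {} \<and> open \<Omega> \<and> connected \<Omega> \<and>
     (\<forall>x0 \<in> frontier \<Omega>. \<exists>r>0. \<exists>e. norm e = 1 \<and>
        (\<exists>g L. L-lipschitz_on {y. y \<bullet> e = 0} g \<and>
           \<Omega> \<inter> ball x0 r = {x \<in> ball x0 r. x \<bullet> e > g (x - (x \<bullet> e) *\<^sub>R e)}))"

text \<open>
  Embeddings by the identity on functions, for function spaces \<open>V\<close>, \<open>W\<close> with norms \<open>nV\<close>, \<open>nW\<close>. For a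
  target \<open>L\<^sup>q(\<Omega>)\<close> only the values on \<open>\<Omega>\<close> enter, so the map is restriction to \<open>\<Omega>\<close>.
\<close>

definition continuously_embedded ::
  "('a \<Rightarrow> real) set \<Rightarrow> (('a \<Rightarrow> real) \<Rightarrow> real) \<Rightarrow> ('a \<Rightarrow> real) set \<Rightarrow> (('a \<Rightarrow> real) \<Rightarrow> real) \<Rightarrow> bool" where
  "continuously_embedded V nV W nW \<longleftrightarrow> V \<subseteq> W \<and> (\<exists>C. \<forall>u\<in>V. nW u \<le> C * nV u)"

definition compactly_embedded ::
  "('a \<Rightarrow> real) set \<Rightarrow> (('a \<Rightarrow> real) \<Rightarrow> real) \<Rightarrow> ('a \<Rightarrow> real) set \<Rightarrow> (('a \<Rightarrow> real) \<Rightarrow> real) \<Rightarrow> bool" where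
  "compactly_embedded V nV W nW \<longleftrightarrow> continuously_embedded V nV W nW \<and>
     (\<forall>u :: nat \<Rightarrow> 'a \<Rightarrow> real. (\<forall>n. u n \<in> V) \<and> (\<exists>B. \<forall>n. nV (u n) \<le> B) \<longrightarrow>
        (\<exists>r v. strict_mono r \<and> v \<in> W \<and> (\<lambda>n. nW (\<lambda>x. u (r n) x - v x)) \<longlonglongrightarrow> 0))"

definition critical_exponent :: "nat \<Rightarrow> real \<Rightarrow> real \<Rightarrow> real" where
  "critical_exponent N s p = real N * p / (real N - s * p)"

end

theory Submission
  imports Defs "HOL-Complex_Analysis.Great_Picard"
begin

text \<open>
Write \<open>N\<close> for the dimension and \<open>q\<close> for the critical exponent. The proof rests on a direct proof of the
fractional Sobolev inequality that keeps track of length scales. For a function \<open>u\<close>, let \<open>G x\<close> be the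
integral of \<open>\<bar>u x - u y\<bar> powr p / norm (x - y) powr (N + s * p)\<close> over the points \<open>y\<close> at distance less than
\<open>\<delta>\<close> from \<open>x\<close>. Comparing \<open>u x\<close> with its average over a ball of radius \<open>r \<le> \<delta>\<close> costs a constant times
\<open>r powr s * G x powr (1 / p)\<close>, while the average itself is at most a constant times
\<open>r powr (- N / q)\<close> times the \<open>L\<^sup>q\<close> norm \<open>U\<close> of \<open>u\<close>. The best \<open>r\<close> gives
\<open>\<bar>u x\<bar> powr q \<le> const * G x * U powr (q - p)\<close>. If the best \<open>r\<close> exceeds \<open>\<delta>\<close>, one compares \<open>u x\<close> with an
average over one of finitely many balls of radius \<open>\<delta> / 2\<close> that cover \<open>\<Omega>\<close>. Integration yields
\<open>localized_sobolev\<close>: up to a constant that does not depend on \<open>\<delta>\<close>, the critical norm of \<open>u\<close> is at most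
\<open>X powr (1 / p)\<close>, where \<open>X\<close> is the Gagliardo energy of \<open>u\<close> at distances below \<open>\<delta>\<close>, plus the sum of
the absolute values of the averages of \<open>u\<close> over these finitely many balls.

The logarithm enters through \<open>near_energy_le_slog_energy\<close>: the energy at distances below \<open>\<delta>\<close> is at most the
logarithmic energy divided by a constant times \<open>- ln \<delta>\<close>. On a set of bounded logarithmic energy the
energy term in the localized inequality is therefore as small as desired, uniformly, and what is
left are finitely many bounded functionals. Along a diagonal subsequence all of these converge, and
the localized inequality, applied to differences, shows that this subsequence is Cauchy in \<open>L\<^sup>q\<close>.

The norm of the space contains no \<open>L\<^sup>p\<close> term, so the ball averages have to be bounded by the energy
alone. The Poincare inequality \<open>poincare\<close> does this by walking out of \<open>\<Omega>\<close> in finitely many short steps.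
With \<open>\<delta> = 1 / 2\<close> the localized inequality then becomes \<open>fractional_sobolev\<close> and gives continuity.
\<close>

section \<open>Powers, averages and the optimal radius\<close>

text \<open>
Below the threshold \<open>t\<close> the first term dominates, above it the second one, because \<open>a - b \<le> 0\<close>.
\<close>
lemma powr_le_split:
  fixes x t a b :: real
  assumes "0 \<le> x" "0 < t" "0 < a" "a \<le> b"
  shows "x powr a \<le> t powr a + t powr (a - b) * x powr b"
proof (cases "x \<le> t")
  case True
  then have "x powr a \<le> t powr a" using assms by (simp add: powr_mono2)
  then show ?thesis by (simp add: add_increasing2)
next
  case False
  then have "x powr a = x powr (a - b) * x powr b"
    using assms by (simp flip: powr_add)
  also have "\<dots> \<le> t powr (a - b) * x powr b"
    using False assms by (intro mult_right_mono powr_mono2') auto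
  finally show ?thesis by (simp add: add_increasing)
qed

text \<open>
This plays the role of Hoelder's inequality for a function and a constant. Integrating the
splitting above and choosing \<open>t\<close> so that both terms are equal gives Hoelder's bound up to the
factor \<open>2\<close>.
\<close>
lemma nn_integral_powr_le:
  fixes f :: "'b \<Rightarrow> real"
  assumes [measurable]: "f \<in> borel_measurable M" "S \<in> sets M"
    and m: "emeasure M S = ennreal m" "0 < m" and ab: "0 < a" "a \<le> b" and I: "0 \<le> I"
    and le: "(\<integral>\<^sup>+x\<in>S. ennreal (\<bar>f x\<bar> powr b) \<partial>M) \<le> ennreal I"
  shows "(\<integral>\<^sup>+x\<in>S. ennreal (\<bar>f x\<bar> powr a) \<partial>M) \<le> ennreal (2 * m powr (1 - a / b) * I powr (a / b))"
proof (cases "I = 0")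
  case True
  then have "(\<integral>\<^sup>+x\<in>S. ennreal (\<bar>f x\<bar> powr b) \<partial>M) = 0" using le by simp
  then have "AE x in M. ennreal (\<bar>f x\<bar> powr b) * indicator S x = 0"
    by (subst (asm) nn_integral_0_iff_AE) auto
  then have "AE x in M. ennreal (\<bar>f x\<bar> powr a) * indicator S x = 0"
    by eventually_elim (auto simp: indicator_def split: if_splits)
  then have "(\<integral>\<^sup>+x\<in>S. ennreal (\<bar>f x\<bar> powr a) \<partial>M) = 0"
    by (subst nn_integral_0_iff_AE) auto
  then show ?thesis by simp
next
  case False
  define t where "t = (I / m) powr (1 / b)"
  have t: "0 < t" using False I m by (simp add: t_def)
  have "(\<integral>\<^sup>+x\<in>S. ennreal (\<bar>f x\<bar> powr a) \<partial>M)
      \<le> (\<integral>\<^sup>+x. ennreal (t powr a) * indicator S x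
            + ennreal (t powr (a - b)) * (ennreal (\<bar>f x\<bar> powr b) * indicator S x) \<partial>M)"
    using powr_le_split[OF _ t ab]
    by (intro nn_integral_mono)
       (auto simp: indicator_def simp flip: ennreal_plus ennreal_mult)
  also have "\<dots> = ennreal (t powr a) * ennreal m
      + ennreal (t powr (a - b)) * (\<integral>\<^sup>+x\<in>S. ennreal (\<bar>f x\<bar> powr b) \<partial>M)"
    by (subst nn_integral_add) (auto simp: nn_integral_cmult m)
  also have "\<dots> \<le> ennreal (t powr a) * ennreal m + ennreal (t powr (a - b)) * ennreal I"
    by (intro add_mono mult_left_mono le) auto
  also have "\<dots> = ennreal (t powr a * m + t powr (a - b) * I)"
    using m I by (simp flip: ennreal_mult ennreal_plus)
  also have "t powr a * m + t powr (a - b) * I = 2 * m powr (1 - a / b) * I powr (a / b)"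
  proof -
    have 1: "t powr a = I powr (a / b) / m powr (a / b)" "t powr b = I / m"
      using False I m ab by (simp_all add: t_def powr_powr powr_divide)
    have 2: "t powr (a - b) = t powr a / t powr b" "m powr (1 - a / b) = m / m powr (a / b)"
      using m by (simp_all add: powr_diff)
    show ?thesis unfolding 2 1 using False I m by simp
  qed
  finally show ?thesis .
qed

text \<open>
With \<open>c = f x\<close> this estimates the distance of a value from an average; with \<open>c = 0\<close> it estimates
the average itself.
\<close>
lemma average_deviation:
  fixes f :: "'b \<Rightarrow> real"
  assumes [measurable]: "f \<in> borel_measurable M" "S \<in> sets M"
    and m: "emeasure M S = ennreal m" "0 < m" and p: "1 \<le> p" and I: "0 \<le> I"
    and int: "set_integrable M S f"
    and le: "(\<integral>\<^sup>+x\<in>S. ennreal (\<bar>c - f x\<bar> powr p) \<partial>M) \<le> ennreal I"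
  shows "\<bar>c - (LINT x:S|M. f x) / m\<bar> \<le> 2 * (I / m) powr (1 / p)"
proof -
  have mS: "measure M S = m" using m by (simp add: measure_def)
  have cint: "set_integrable M S (\<lambda>x. c)" using m by (simp add: set_integrable_def)
  have sint: "set_integrable M S (\<lambda>x. c - f x)" by (intro set_integral_diff cint int)
  have "c * m - (LINT x:S|M. f x) = (LINT x:S|M. c - f x)"
    using set_integral_diff(2)[OF cint int] m
    by (simp add: set_lebesgue_integral_def mS)
  then have "ennreal \<bar>c * m - (LINT x:S|M. f x)\<bar>
      \<le> (\<integral>\<^sup>+x\<in>S. ennreal (\<bar>c - f x\<bar> powr 1) \<partial>M)"
    using integral_norm_bound_ennreal[OF sint[unfolded set_integrable_def]]
    by (simp add: set_lebesgue_integral_def ennreal_mult ennreal_indicator abs_mult mult.commute)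
  also have "\<dots> \<le> ennreal (2 * m powr (1 - 1 / p) * I powr (1 / p))"
    by (rule nn_integral_powr_le) (use m p I le in auto)
  finally have "\<bar>c * m - (LINT x:S|M. f x)\<bar> \<le> 2 * m powr (1 - 1 / p) * I powr (1 / p)"
    by (subst (asm) ennreal_le_iff) auto
  then have "\<bar>c * m - (LINT x:S|M. f x)\<bar> / m \<le> (2 * m powr (1 - 1 / p) * I powr (1 / p)) / m"
    using m by (intro divide_right_mono) auto
  also have "\<bar>c * m - (LINT x:S|M. f x)\<bar> / m = \<bar>c - (LINT x:S|M. f x) / m\<bar>"
  proof -
    have "\<bar>c * m - (LINT x:S|M. f x)\<bar> / m = \<bar>(c * m - (LINT x:S|M. f x)) / m\<bar>"
      using m by simp
    also have "(c * m - (LINT x:S|M. f x)) / m = c - (LINT x:S|M. f x) / m"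
      using m by (simp add: diff_divide_distrib)
    finally show ?thesis .
  qed
  also have "(2 * m powr (1 - 1 / p) * I powr (1 / p)) / m = 2 * (I / m) powr (1 / p)"
    using m I by (simp add: powr_divide powr_diff field_simps)
  finally show ?thesis .
qed

text \<open>
The two terms of the first bound coincide at \<open>r = (B / A) powr (p / N)\<close>, since
\<open>s + N / q = N / p\<close>. If this radius exceeds \<open>\<delta>\<close>, then \<open>A * \<delta> powr s\<close> is already at most the
common value, and the bound at radius \<open>\<delta>\<close> suffices.
\<close>
lemma optimal_radius_bound:
  fixes a A B K K' M N p q s \<delta> :: real
  assumes pos: "0 \<le> A" "0 < B" "0 \<le> K" "0 \<le> K'" "0 < \<delta>" "0 \<le> M" "0 < s" "1 < p" "s * p < N"
    and q: "q = N * p / (N - s * p)"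
    and small: "\<And>r. 0 < r \<Longrightarrow> r \<le> \<delta> \<Longrightarrow> a \<le> K * A * r powr s + K' * B * r powr (- N / q)"
    and fixed: "a \<le> K * A * \<delta> powr s + M"
  shows "a \<le> (K + K') * A powr (p / q) * B powr (1 - p / q) + M"
proof (cases "A = 0")
  case True
  then show ?thesis using fixed by simp
next
  case False
  then have A: "0 < A" using pos by simp
  have N: "0 < N" using pos by (smt (verit) mult_pos_pos)
  have pq: "p / q = 1 - s * p / N" using pos N by (simp add: q field_simps)
  have Nq: "N / q * (p / N) = p / q" using N by simp
  define r where "r = (B / A) powr (p / N)"
  have r: "0 < r" using A pos by (simp add: r_def)
  have 1: "A * r powr s = A powr (p / q) * B powr (1 - p / q)"
    using A pos by (simp add: r_def powr_powr powr_divide pq powr_diff mult.commute)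
  have "r powr (- N / q) = (B / A) powr (- (p / q))"
    using Nq by (simp add: r_def powr_powr mult.commute)
  then have 2: "B * r powr (- N / q) = A powr (p / q) * B powr (1 - p / q)"
    using A pos by (simp add: powr_minus powr_divide powr_diff)
  show ?thesis
  proof (cases "r \<le> \<delta>")
    case True
    have "a \<le> K * (A * r powr s) + K' * (B * r powr (- N / q))"
      using small[OF r True] by (simp add: mult.assoc)
    also have "\<dots> = (K + K') * A powr (p / q) * B powr (1 - p / q)"
      unfolding 1 2 by (simp add: algebra_simps)
    finally show ?thesis using pos by simp
  next
    case False
    have "a \<le> K * (A * \<delta> powr s) + M" using fixed by (simp add: mult.assoc)
    also have "\<dots> \<le> K * (A * r powr s) + M"
      using False pos by (intro add_right_mono mult_left_mono powr_mono2) auto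
    also have "\<dots> = K * A powr (p / q) * B powr (1 - p / q) + M"
      unfolding 1 by (simp add: algebra_simps)
    also have "\<dots> \<le> (K + K') * A powr (p / q) * B powr (1 - p / q) + M"
      using pos by (intro add_right_mono mult_right_mono) auto
    finally show ?thesis .
  qed
qed

section \<open>Pointwise bound by the short-range energy\<close>

text \<open>
\<open>near_density\<close> is the Gagliardo density at \<open>x\<close> of the increments of length less than \<open>\<delta>\<close>; its
integral \<open>near_energy\<close> is the Gagliardo energy restricted to pairs of points closer than \<open>\<delta>\<close>.
\<close>
definition near_density :: "real \<Rightarrow> real \<Rightarrow> real \<Rightarrow> ('a::euclidean_space \<Rightarrow> real) \<Rightarrow> 'a \<Rightarrow> ennreal" where
  "near_density \<delta> s p u x =
     (\<integral>\<^sup>+y. ennreal (\<bar>u x - u y\<bar> powr p / norm (x - y) powr (real DIM('a) + s * p))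
              * indicator {z. norm z < \<delta>} (x - y) \<partial>lborel)"

definition near_energy :: "real \<Rightarrow> real \<Rightarrow> real \<Rightarrow> ('a::euclidean_space \<Rightarrow> real) \<Rightarrow> ennreal" where
  "near_energy \<delta> s p u = (\<integral>\<^sup>+x. near_density \<delta> s p u x \<partial>lborel)"

definition ball_average :: "('a::euclidean_space \<Rightarrow> real) \<Rightarrow> 'a \<Rightarrow> real \<Rightarrow> real" where
  "ball_average u z r = (LINT y:ball z r|lborel. u y) / measure lborel (ball z r)"

text \<open>
Working with Borel functions that vanish everywhere outside \<open>\<Omega>\<close>, instead of Lebesgue measurable
ones that vanish there almost everywhere, makes Fubini's theorem and pointwise evaluation available.
\<close>
definition borel_supported :: "'a::euclidean_space set \<Rightarrow> ('a \<Rightarrow> real) set" where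
  "borel_supported \<Omega> = {u \<in> borel_measurable borel. \<forall>x. x \<notin> \<Omega> \<longrightarrow> u x = 0}"

lemma borel_measurable_near_density [measurable]:
  assumes [measurable]: "u \<in> borel_measurable borel"
  shows "near_density \<delta> s p u \<in> borel_measurable borel"
  unfolding near_density_def by measurable

lemma powr_add_le:
  fixes a b q :: real
  assumes "0 \<le> a" "0 \<le> b" "0 \<le> q"
  shows "(a + b) powr q \<le> 2 powr q * (a powr q + b powr q)"
proof -
  have "(a + b) powr q \<le> (2 * max a b) powr q"
    using assms by (intro powr_mono2) auto
  also have "\<dots> = 2 powr q * max a b powr q" using assms by (simp add: powr_mult)
  also have "\<dots> \<le> 2 powr q * (a powr q + b powr q)"
    by (intro mult_left_mono) (auto simp: max_def)
  finally show ?thesis .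
qed

lemma emeasure_ball_eq_measure: "emeasure lborel (ball c r) = ennreal (measure lborel (ball c r))"
  using emeasure_lborel_ball_finite[of c r] by (intro emeasure_eq_ennreal_measure) auto

text \<open>
The ball is not centred at \<open>x\<close>: it is enough that it lies within distance \<open>r\<close> of \<open>x\<close> and has volume
comparable to \<open>r ^ N\<close>. This freedom makes it possible to use finitely many balls for all \<open>x\<close>.
On such a ball \<open>norm (x - y) powr (N + s * p) \<le> r powr (N + s * p)\<close>, and dividing by the volume
leaves \<open>r powr (s * p)\<close>.
\<close>
lemma ball_average_deviation:
  fixes u :: "'a::euclidean_space \<Rightarrow> real"
  assumes [measurable]: "u \<in> borel_measurable borel"
    and p: "1 \<le> p" "0 < s" and r: "0 < r" "r \<le> \<delta>" and z: "dist z x < r / 2"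
    and int: "set_integrable lborel (ball z (r / 2)) u"
    and G: "near_density \<delta> s p u x \<le> ennreal G" "0 \<le> G"
  shows "\<bar>u x - ball_average u z (r / 2)\<bar>
    \<le> 2 * (2 ^ DIM('a) / unit_ball_vol (real DIM('a))) powr (1 / p) * G powr (1 / p) * r powr s"
proof -
  let ?n = "DIM('a)" let ?w = "unit_ball_vol (real DIM('a))"
  define e where "e = real ?n + s * p"
  have e: "0 < e" using p by (simp add: e_def add_nonneg_pos)
  define W where "W = 2 ^ ?n / ?w"
  have w: "0 < W" by (simp add: W_def)
  have pw: "ennreal (\<bar>u x - u y\<bar> powr p) * indicator (ball z (r / 2)) y
      \<le> ennreal (r powr e) * (ennreal (\<bar>u x - u y\<bar> powr p / norm (x - y) powr e)
           * indicator {z. norm z < \<delta>} (x - y))" for y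
  proof (cases "y \<in> ball z (r / 2) \<and> x \<noteq> y")
    case True
    have "dist x y < r" using True z dist_triangle2[of x y z] by (simp add: dist_commute)
    then have d: "norm (x - y) < r" by (simp add: dist_norm)
    have "\<bar>u x - u y\<bar> powr p = norm (x - y) powr e * (\<bar>u x - u y\<bar> powr p / norm (x - y) powr e)"
      using True by simp
    also have "\<dots> \<le> r powr e * (\<bar>u x - u y\<bar> powr p / norm (x - y) powr e)"
      using d e by (intro mult_right_mono powr_mono2) auto
    finally show ?thesis using True d r by (simp flip: ennreal_mult)
  next
    case False
    then show ?thesis using p by (auto simp: indicator_def)
  qed
  have "(\<integral>\<^sup>+y\<in>ball z (r / 2). ennreal (\<bar>u x - u y\<bar> powr p) \<partial>lborel)
      \<le> ennreal (r powr e) * near_density \<delta> s p u x"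
    unfolding near_density_def e_def[symmetric]
    by (subst nn_integral_cmult[symmetric]) (auto intro!: nn_integral_mono pw)
  also have "\<dots> \<le> ennreal (r powr e) * ennreal G"
    using G by (intro mult_left_mono) auto
  finally have le: "(\<integral>\<^sup>+y\<in>ball z (r / 2). ennreal (\<bar>u x - u y\<bar> powr p) \<partial>lborel)
      \<le> ennreal (r powr e * G)" using G by (simp add: ennreal_mult)
  have c: "measure lborel (ball z (r / 2)) = ?w * (r / 2) ^ ?n" using r by (simp add: content_ball)
  have "\<bar>u x - ball_average u z (r / 2)\<bar>
      \<le> 2 * ((r powr e * G) / measure lborel (ball z (r / 2))) powr (1 / p)"
    unfolding ball_average_def
    by (rule average_deviation[OF _ _ _ _ p(1) _ int le])
       (use r G in \<open>auto simp: emeasure_ball_eq_measure\<close>)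
  also have "(r powr e * G) / measure lborel (ball z (r / 2)) = W * G * r powr (s * p)"
    using r by (simp add: c W_def e_def powr_add powr_realpow power_divide)
  also have "\<dots> powr (1 / p) = W powr (1 / p) * G powr (1 / p) * r powr s"
    using r p G w by (simp add: powr_mult powr_powr)
  finally show ?thesis by (simp add: mult.assoc W_def)
qed

lemma ball_average_bound:
  fixes u :: "'a::euclidean_space \<Rightarrow> real"
  assumes [measurable]: "u \<in> borel_measurable borel"
    and q: "1 \<le> q" and r: "0 < r" and int: "set_integrable lborel (ball z (r / 2)) u"
    and U: "(\<integral>\<^sup>+y. ennreal (\<bar>u y\<bar> powr q) \<partial>lborel) \<le> ennreal (U powr q)" "0 \<le> U"
  shows "\<bar>ball_average u z (r / 2)\<bar>
    \<le> 2 * (2 ^ DIM('a) / unit_ball_vol (real DIM('a))) powr (1 / q) * U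
        * r powr (- real DIM('a) / q)"
proof -
  let ?n = "DIM('a)" let ?w = "unit_ball_vol (real DIM('a))"
  define W where "W = 2 ^ ?n / ?w"
  have w: "0 < W" by (simp add: W_def)
  have c: "measure lborel (ball z (r / 2)) = ?w * (r / 2) ^ ?n" using r by (simp add: content_ball)
  have "(\<integral>\<^sup>+y\<in>ball z (r / 2). ennreal (\<bar>0 - u y\<bar> powr q) \<partial>lborel)
      \<le> (\<integral>\<^sup>+y. ennreal (\<bar>u y\<bar> powr q) \<partial>lborel)"
    by (intro nn_integral_mono) (auto simp: indicator_def)
  then have le: "(\<integral>\<^sup>+y\<in>ball z (r / 2). ennreal (\<bar>0 - u y\<bar> powr q) \<partial>lborel) \<le> ennreal (U powr q)"
    using U by order
  have "\<bar>0 - ball_average u z (r / 2)\<bar> \<le> 2 * (U powr q / measure lborel (ball z (r / 2))) powr (1 / q)"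
    unfolding ball_average_def
    by (rule average_deviation[OF _ _ _ _ q _ int le])
       (use r in \<open>auto simp: emeasure_ball_eq_measure\<close>)
  also have "U powr q / measure lborel (ball z (r / 2)) = W * U powr q * r powr (- real ?n)"
    using r by (simp add: c W_def powr_minus powr_realpow power_divide field_simps)
  also have "\<dots> powr (1 / q) = W powr (1 / q) * U * r powr (- real ?n / q)"
    using r q U w by (simp add: powr_mult powr_powr)
  finally show ?thesis by (simp add: mult.assoc W_def)
qed

text \<open>
Combines two estimates of \<open>u x\<close>. At radii below \<open>\<delta>\<close>, the average over the ball centred at \<open>x\<close> is
controlled by the \<open>L\<^sup>q\<close> norm \<open>U\<close>. At radius \<open>\<delta>\<close>, \<open>u x\<close> is compared with the average over a ball of
the given finite family. Only finitely many linear functionals of \<open>u\<close> remain beside the term that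
carries the energy.
\<close>
lemma pointwise_bound:
  fixes u :: "'a::euclidean_space \<Rightarrow> real"
  assumes [measurable]: "u \<in> borel_measurable borel"
    and p: "1 < p" "0 < s" "s * p < real DIM('a)" and q: "q = critical_exponent DIM('a) s p"
    and \<delta>: "0 < \<delta>" and C: "finite C" "x \<in> (\<Union>c\<in>C. ball c (\<delta> / 2))"
    and int: "integrable lborel u"
    and U: "(\<integral>\<^sup>+y. ennreal (\<bar>u y\<bar> powr q) \<partial>lborel) \<le> ennreal (U powr q)" "0 < U"
    and G: "near_density \<delta> s p u x \<le> ennreal G" "0 \<le> G"
  defines "w \<equiv> 2 ^ DIM('a) / unit_ball_vol (real DIM('a))"
  shows "\<bar>u x\<bar> \<le> 2 * (w powr (1 / p) + w powr (1 / q)) * (G powr (1 / q) * U powr (1 - p / q))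
     + (\<Sum>c\<in>C. \<bar>ball_average u c (\<delta> / 2)\<bar>)"
proof -
  let ?M = "\<Sum>c\<in>C. \<bar>ball_average u c (\<delta> / 2)\<bar>"
  have "1 * (real DIM('a) - s * p) \<le> p * real DIM('a)"
    using p by (intro mult_mono) auto
  then have q1: "1 \<le> q" using p by (simp add: q critical_exponent_def mult.commute)
  have int': "set_integrable lborel (ball z t) u" for z t
    unfolding set_integrable_def using int by (intro integrable_mult_indicator) auto
  have small: "\<bar>u x\<bar> \<le> 2 * w powr (1 / p) * G powr (1 / p) * r powr s
      + 2 * w powr (1 / q) * U * r powr (- real DIM('a) / q)" if "0 < r" "r \<le> \<delta>" for r
  proof -
    have "\<bar>u x - ball_average u x (r / 2)\<bar> \<le> 2 * w powr (1 / p) * G powr (1 / p) * r powr s"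
      unfolding w_def by (rule ball_average_deviation) (use p that int' G in auto)
    moreover have "\<bar>ball_average u x (r / 2)\<bar> \<le> 2 * w powr (1 / q) * U * r powr (- real DIM('a) / q)"
      unfolding w_def by (rule ball_average_bound) (use q1 that int' U in auto)
    ultimately show ?thesis by linarith
  qed
  have fixed: "\<bar>u x\<bar> \<le> 2 * w powr (1 / p) * G powr (1 / p) * \<delta> powr s + ?M"
  proof -
    obtain c where c: "c \<in> C" "dist c x < \<delta> / 2" using C by auto
    have "\<bar>u x - ball_average u c (\<delta> / 2)\<bar> \<le> 2 * w powr (1 / p) * G powr (1 / p) * \<delta> powr s"
      unfolding w_def by (rule ball_average_deviation) (use p \<delta> c int' G in auto)
    moreover have "\<bar>ball_average u c (\<delta> / 2)\<bar> \<le> ?M"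
      using c C by (intro member_le_sum) auto
    ultimately show ?thesis by linarith
  qed
  have "\<bar>u x\<bar> \<le> (2 * w powr (1 / p) + 2 * w powr (1 / q)) * (G powr (1 / p)) powr (p / q)
      * U powr (1 - p / q) + ?M"
    by (rule optimal_radius_bound[OF _ _ _ _ \<delta> _ p(2,1,3)])
       (use small fixed U q in \<open>auto simp: critical_exponent_def intro: sum_nonneg\<close>)
  also have "(G powr (1 / p)) powr (p / q) = G powr (1 / q)" using p by (simp add: powr_powr)
  finally show ?thesis by (simp add: algebra_simps)
qed

section \<open>Localized Sobolev inequality\<close>

text \<open>
If \<open>U powr q\<close> is bounded by a sum, it is at most twice the larger summand.
\<close>
lemma le_of_powr_le_absorbing:
  fixes a b U p q :: real
  assumes U: "0 < U" and p: "0 < p" "p < q" and a: "0 \<le> a" and b: "0 \<le> b"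
    and le: "U powr q \<le> a * U powr (q - p) + b"
  shows "U \<le> (2 * a) powr (1 / p) + (2 * b) powr (1 / q)"
proof (cases "b \<le> a * U powr (q - p)")
  case True
  have "U powr p * U powr (q - p) \<le> 2 * a * U powr (q - p)"
    using le True by (simp flip: powr_add)
  then have "U powr p \<le> 2 * a" using U by simp
  then have "(U powr p) powr (1 / p) \<le> (2 * a) powr (1 / p)"
    using p by (intro powr_mono2) auto
  then show ?thesis using U p by (simp add: powr_powr add_increasing2)
next
  case False
  then have "U powr q \<le> 2 * b" using le by simp
  then have "(U powr q) powr (1 / q) \<le> (2 * b) powr (1 / q)"
    using p by (intro powr_mono2) auto
  then show ?thesis using U p by (simp add: powr_powr add_increasing)
qed

text \<open>
Raise the pointwise bound to the power \<open>q\<close> and integrate: the density becomes the energy \<open>X\<close>, the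
factor \<open>U powr (q - p)\<close> is absorbed on the left, and the averages contribute the constant
\<open>(\<Sum>c\<in>C. \<bar>ball_average u c (\<delta> / 2)\<bar>) powr q\<close> on a set of finite measure. It is essential that \<open>K\<close>
does not depend on \<open>\<delta>\<close> and \<open>C\<close>: letting \<open>\<delta>\<close> tend to \<open>0\<close> will make \<open>X\<close> small.
\<close>
lemma localized_sobolev:
  fixes \<Omega> :: "'a::euclidean_space set"
  assumes p: "1 < p" "0 < s" "s * p < real DIM('a)" and q: "q = critical_exponent DIM('a) s p"
    and \<Omega>: "\<Omega> \<in> sets borel" "bounded \<Omega>"
  obtains K where "0 \<le> K"
    "\<And>u \<delta> C U X. \<lbrakk>u \<in> borel_supported \<Omega>; integrable lborel u;
       (\<integral>\<^sup>+x. ennreal (\<bar>u x\<bar> powr q) \<partial>lborel) = ennreal (U powr q); 0 \<le> U;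
       0 < \<delta>; finite C; \<Omega> \<subseteq> (\<Union>c\<in>C. ball c (\<delta> / 2)); near_energy \<delta> s p u \<le> ennreal X; 0 \<le> X\<rbrakk>
     \<Longrightarrow> U \<le> K * (X powr (1 / p) + (\<Sum>c\<in>C. \<bar>ball_average u c (\<delta> / 2)\<bar>))"
proof -
  define w where "w = 2 ^ DIM('a) / unit_ball_vol (real DIM('a))"
  define L where "L = 2 * (w powr (1 / p) + w powr (1 / q))"
  define a where "a = 2 powr q * L powr q"
  define b where "b = 2 powr q * measure lborel \<Omega>"
  define K where "K = (2 * a) powr (1 / p) + (2 * b) powr (1 / q)"
  have "0 < w" by (simp add: w_def)
  then have L: "0 < L" by (simp add: L_def add_pos_pos)
  then have a: "0 < a" by (simp add: a_def)
  have b: "0 \<le> b" by (simp add: b_def)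
  have "p * (real DIM('a) - s * p) < p * real DIM('a)" using p by simp
  then have pq: "p < q" using p by (simp add: q critical_exponent_def field_simps)
  have "emeasure lborel \<Omega> < \<infinity>" using \<Omega>(2) by (rule emeasure_bounded_finite)
  then have em: "emeasure lborel \<Omega> = ennreal (measure lborel \<Omega>)"
    by (intro emeasure_eq_ennreal_measure) auto
  have [measurable]: "\<Omega> \<in> sets borel" by fact
  show ?thesis
  proof (rule that[of K])
    show "0 \<le> K" by (simp add: K_def)
    fix u :: "'a \<Rightarrow> real" and \<delta> C U X
    assume u: "u \<in> borel_supported \<Omega>"
      and int: "integrable lborel u"
      and U: "(\<integral>\<^sup>+x. ennreal (\<bar>u x\<bar> powr q) \<partial>lborel) = ennreal (U powr q)" "0 \<le> U"
      and \<delta>: "0 < \<delta>" and C: "finite C" "\<Omega> \<subseteq> (\<Union>c\<in>C. ball c (\<delta> / 2))"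
      and X: "near_energy \<delta> s p u \<le> ennreal X" "0 \<le> X"
    have [measurable]: "u \<in> borel_measurable borel" and u0: "\<forall>x. x \<notin> \<Omega> \<longrightarrow> u x = 0"
      using u by (auto simp: borel_supported_def)
    define S where "S = (\<Sum>c\<in>C. \<bar>ball_average u c (\<delta> / 2)\<bar>)"
    have S: "0 \<le> S" by (simp add: S_def sum_nonneg)
    have "U \<le> (2 * (a * X)) powr (1 / p) + (2 * (b * S powr q)) powr (1 / q)" if U0: "0 < U"
    proof (rule le_of_powr_le_absorbing[OF U0 _ pq])
      have pw: "ennreal (\<bar>u x\<bar> powr q) \<le> ennreal (a * U powr (q - p)) * near_density \<delta> s p u x
          + ennreal (2 powr q * S powr q) * indicator \<Omega> x" for x
      proof (cases "x \<in> \<Omega> \<and> near_density \<delta> s p u x < \<infinity>")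
        case True
        define G where "G = enn2real (near_density \<delta> s p u x)"
        have G: "near_density \<delta> s p u x = ennreal G" "0 \<le> G" using True by (auto simp: G_def)
        have xC: "x \<in> (\<Union>c\<in>C. ball c (\<delta> / 2))" using True C by blast
        have "\<bar>u x\<bar> \<le> L * (G powr (1 / q) * U powr (1 - p / q)) + S"
          unfolding L_def w_def S_def
          by (rule pointwise_bound[OF _ p q \<delta> C(1) xC int _ U0]) (use U G in auto)
        then have "\<bar>u x\<bar> powr q \<le> (L * (G powr (1 / q) * U powr (1 - p / q)) + S) powr q"
          using p pq by (intro powr_mono2) auto
        also have "\<dots> \<le> 2 powr q * ((L * (G powr (1 / q) * U powr (1 - p / q))) powr q + S powr q)"
          using p pq L S by (intro powr_add_le) auto
        also have "(L * (G powr (1 / q) * U powr (1 - p / q))) powr q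
            = L powr q * (G * U powr (q - p))"
          using L G p pq by (simp add: powr_mult powr_powr left_diff_distrib)
        finally have "\<bar>u x\<bar> powr q \<le> a * U powr (q - p) * G + 2 powr q * S powr q"
          by (simp add: a_def algebra_simps)
        then show ?thesis using True a G
          by (simp add: ennreal_mult[symmetric] ennreal_plus[symmetric] del: ennreal_plus)
      next
        case False
        \<comment> \<open>On \<open>\<Omega>\<close> the density is infinite, and so is the right-hand side, its factor being positive.\<close>
        have "0 < a * U powr (q - p)" using a U0 by simp
        then show ?thesis using False u0 p pq
          by (cases "x \<in> \<Omega>") (auto simp: ennreal_mult_top less_top[symmetric])
      qed
      have "ennreal (U powr q) \<le> (\<integral>\<^sup>+x. ennreal (a * U powr (q - p)) * near_density \<delta> s p u x
          + ennreal (2 powr q * S powr q) * indicator \<Omega> x \<partial>lborel)"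
        unfolding U(1)[symmetric] by (intro nn_integral_mono pw)
      also have "\<dots> = ennreal (a * U powr (q - p)) * near_energy \<delta> s p u
          + ennreal (2 powr q * S powr q) * ennreal (measure lborel \<Omega>)"
        by (simp add: nn_integral_add nn_integral_cmult near_energy_def em)
      also have "\<dots> \<le> ennreal (a * U powr (q - p)) * ennreal X
          + ennreal (2 powr q * S powr q) * ennreal (measure lborel \<Omega>)"
        by (intro add_mono mult_left_mono X) auto
      also have "\<dots> = ennreal (a * X * U powr (q - p) + b * S powr q)"
        using a X by (simp add: ennreal_mult[symmetric] ennreal_plus[symmetric] b_def mult_ac
            del: ennreal_plus)
      finally show "U powr q \<le> a * X * U powr (q - p) + b * S powr q"
        using a b X by (subst (asm) ennreal_le_iff) auto
    qed (use p a b X in auto)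
    also have "(2 * (a * X)) powr (1 / p) = (2 * a) powr (1 / p) * X powr (1 / p)"
      using a X by (simp add: powr_mult)
    also have "(2 * (b * S powr q)) powr (1 / q) = (2 * b) powr (1 / q) * S"
      using b S p pq by (simp add: powr_mult powr_powr)
    also have "(2 * a) powr (1 / p) * X powr (1 / p) + (2 * b) powr (1 / q) * S
       \<le> K * X powr (1 / p) + K * S"
      unfolding K_def using S by (intro add_mono mult_right_mono) auto
    finally have "0 < U \<Longrightarrow> U \<le> K * (X powr (1 / p) + S)" by (simp add: distrib_left)
    moreover have "0 \<le> K * (X powr (1 / p) + S)" using S by (simp add: K_def)
    ultimately show "U \<le> K * (X powr (1 / p) + (\<Sum>c\<in>C. \<bar>ball_average u c (\<delta> / 2)\<bar>))"
      using U(2) unfolding S_def by (cases "U = 0") auto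
  qed
qed

section \<open>Short-range energy and logarithmic energy\<close>

lemma near_energy_diff_le:
  fixes u v :: "'a::euclidean_space \<Rightarrow> real"
  assumes [measurable]: "u \<in> borel_measurable borel" "v \<in> borel_measurable borel" and p: "0 \<le> p"
  shows "near_energy \<delta> s p (\<lambda>x. u x - v x)
    \<le> ennreal (2 powr p) * (near_energy \<delta> s p u + near_energy \<delta> s p v)"
proof -
  have "near_density \<delta> s p (\<lambda>x. u x - v x) x
      \<le> ennreal (2 powr p) * (near_density \<delta> s p u x + near_density \<delta> s p v x)" for x
  proof -
    let ?k = "\<lambda>y. norm (x - y) powr (real DIM('a) + s * p)"
    have "\<bar>(u x - v x) - (u y - v y)\<bar> powr p / ?k y
        \<le> 2 powr p * (\<bar>u x - u y\<bar> powr p / ?k y + \<bar>v x - v y\<bar> powr p / ?k y)" for y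
    proof -
      have "\<bar>(u x - v x) - (u y - v y)\<bar> powr p \<le> (\<bar>u x - u y\<bar> + \<bar>v x - v y\<bar>) powr p"
        using p by (intro powr_mono2) auto
      also have "\<dots> \<le> 2 powr p * (\<bar>u x - u y\<bar> powr p + \<bar>v x - v y\<bar> powr p)"
        using p by (intro powr_add_le) auto
      finally have "\<bar>(u x - v x) - (u y - v y)\<bar> powr p / ?k y
        \<le> 2 powr p * (\<bar>u x - u y\<bar> powr p + \<bar>v x - v y\<bar> powr p) / ?k y"
        by (rule divide_right_mono) simp
      then show ?thesis by (simp add: add_divide_distrib[symmetric])
    qed
    then have "near_density \<delta> s p (\<lambda>x. u x - v x) x
       \<le> (\<integral>\<^sup>+y. ennreal (2 powr p) * (ennreal (\<bar>u x - u y\<bar> powr p / ?k y) * indicator {z. norm z < \<delta>} (x - y)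
           + ennreal (\<bar>v x - v y\<bar> powr p / ?k y) * indicator {z. norm z < \<delta>} (x - y)) \<partial>lborel)"
      unfolding near_density_def
      by (intro nn_integral_mono)
         (auto simp: indicator_def ennreal_mult[symmetric] ennreal_plus[symmetric] simp del: ennreal_plus)
    also have "\<dots> = ennreal (2 powr p) * (near_density \<delta> s p u x + near_density \<delta> s p v x)"
      unfolding near_density_def by (simp add: nn_integral_cmult nn_integral_add)
    finally show ?thesis .
  qed
  then have "near_energy \<delta> s p (\<lambda>x. u x - v x)
      \<le> (\<integral>\<^sup>+x. ennreal (2 powr p) * (near_density \<delta> s p u x + near_density \<delta> s p v x) \<partial>lborel)"
    unfolding near_energy_def by (intro nn_integral_mono)
  also have "\<dots> = ennreal (2 powr p) * (near_energy \<delta> s p u + near_energy \<delta> s p v)"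
    unfolding near_energy_def by (simp add: nn_integral_cmult nn_integral_add)
  finally show ?thesis .
qed

lemma near_energy_contraction:
  assumes "\<And>x y. \<bar>v x - v y\<bar> \<le> \<bar>u x - u y\<bar>" and "0 \<le> p"
  shows "near_energy \<delta> s p v \<le> near_energy \<delta> s p u"
  unfolding near_energy_def near_density_def
  using assms by (intro nn_integral_mono mult_right_mono ennreal_leI divide_right_mono powr_mono2) auto

lemma frac_const_pos:
  assumes "0 < s" "s < 1" "0 < p"
  shows "0 < frac_const n s p"
  using assms by (auto simp: frac_const_def intro!: divide_pos_pos mult_pos_pos Gamma_real_pos add_nonneg_pos)

lemma slog_energy_iterated:
  fixes u :: "'a::euclidean_space \<Rightarrow> real"
  assumes [measurable]: "u \<in> borel_measurable borel"
  shows "slog_energy s p u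
    = (\<integral>\<^sup>+x. \<integral>\<^sup>+y. ennreal (\<bar>u x - u y\<bar> powr p * log_kernel_plus s p (x - y)) \<partial>lborel \<partial>lborel)"
proof -
  have [measurable]: "log_kernel_plus s p \<in> borel_measurable (borel :: 'a measure)"
    unfolding log_kernel_plus_def by measurable
  have "slog_energy s p u = (\<integral>\<^sup>+ z. ennreal (\<bar>u (fst z) - u (snd z)\<bar> powr p
      * log_kernel_plus s p (fst z - snd z)) \<partial>(lborel \<Otimes>\<^sub>M lborel))"
    unfolding slog_energy_def nn_integral_completion lborel_prod
    by (simp add: case_prod_unfold)
  also have "\<dots> = (\<integral>\<^sup>+x. \<integral>\<^sup>+y. ennreal (\<bar>u x - u y\<bar> powr p * log_kernel_plus s p (x - y)) \<partial>lborel \<partial>lborel)"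
    by (subst lborel.nn_integral_fst[symmetric]) auto
  finally show ?thesis .
qed

text \<open>
The kernel with the logarithm exceeds the Gagliardo kernel by the factor \<open>- ln \<delta>\<close> at distances below
\<open>\<delta>\<close>. As \<open>\<delta>\<close> tends to \<open>0\<close> this factor tends to infinity, so a bound on the logarithmic energy makes
the short-range energies uniformly small. This gain is what yields compactness at the critical
exponent.
\<close>
lemma near_energy_le_slog_energy:
  fixes u :: "'a::euclidean_space \<Rightarrow> real"
  assumes [measurable]: "u \<in> borel_measurable borel"
    and s: "0 < s" "s < 1" "0 < p" and \<delta>: "0 < \<delta>" "\<delta> < 1"
  shows "ennreal (frac_const DIM('a) s p * - ln \<delta>) * near_energy \<delta> s p u \<le> slog_energy s p u"
proof -
  let ?c = "frac_const DIM('a) s p"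
  have c: "0 < ?c" using s by (rule frac_const_pos)
  have pw: "ennreal (?c * - ln \<delta>) * (ennreal (\<bar>u x - u y\<bar> powr p / norm (x - y) powr (real DIM('a) + s * p))
        * indicator {z. norm z < \<delta>} (x - y))
      \<le> ennreal (\<bar>u x - u y\<bar> powr p * log_kernel_plus s p (x - y))" for x y
  proof (cases "x \<noteq> y \<and> norm (x - y) < \<delta>")
    case True
    then have "ln (norm (x - y)) \<le> ln \<delta>" using \<delta> by (subst ln_le_cancel_iff) auto
    then have "- ln \<delta> \<le> max 0 (- ln (norm (x - y)))" by simp
    then have "?c * - ln \<delta> * (\<bar>u x - u y\<bar> powr p / norm (x - y) powr (real DIM('a) + s * p))
       \<le> ?c * max 0 (- ln (norm (x - y))) * (\<bar>u x - u y\<bar> powr p / norm (x - y) powr (real DIM('a) + s * p))"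
      using c by (intro mult_right_mono mult_left_mono) auto
    also have "\<dots> = \<bar>u x - u y\<bar> powr p * log_kernel_plus s p (x - y)"
      by (simp add: log_kernel_plus_def)
    finally have le: "?c * - ln \<delta> * (\<bar>u x - u y\<bar> powr p / norm (x - y) powr (real DIM('a) + s * p))
       \<le> \<bar>u x - u y\<bar> powr p * log_kernel_plus s p (x - y)" .
    have "0 \<le> ?c * - ln \<delta>" using c \<delta> by (intro mult_nonneg_nonneg) auto
    from ennreal_leI[OF le, unfolded ennreal_mult'[OF this]] show ?thesis using True by simp
  next
    case False
    then show ?thesis using s by (auto simp: indicator_def)
  qed
  have "ennreal (?c * - ln \<delta>) * near_energy \<delta> s p u = (\<integral>\<^sup>+x. \<integral>\<^sup>+y. ennreal (?c * - ln \<delta>)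
     * (ennreal (\<bar>u x - u y\<bar> powr p / norm (x - y) powr (real DIM('a) + s * p))
        * indicator {z. norm z < \<delta>} (x - y)) \<partial>lborel \<partial>lborel)"
    unfolding near_energy_def near_density_def
    by (simp add: nn_integral_cmult)
  also have "\<dots> \<le> slog_energy s p u"
    unfolding slog_energy_iterated[OF assms(1)] by (intro nn_integral_mono pw)
  finally show ?thesis .
qed

section \<open>Poincare inequality\<close>

lemma nn_integral_lborel_shift:
  fixes f :: "'a::euclidean_space \<Rightarrow> ennreal"
  assumes [measurable]: "f \<in> borel_measurable borel"
  shows "(\<integral>\<^sup>+x. f (c + x) \<partial>lborel) = (\<integral>\<^sup>+x. f x \<partial>lborel)"
proof -
  have "(\<integral>\<^sup>+x. f x \<partial>lborel) = (\<integral>\<^sup>+x. f x \<partial>distr lborel borel ((+) c))"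
    by (simp add: lborel_distr_plus)
  also have "\<dots> = (\<integral>\<^sup>+x. f (c + x) \<partial>lborel)" by (subst nn_integral_distr) auto
  finally show ?thesis by simp
qed

lemma near_energy_translations:
  fixes u :: "'a::euclidean_space \<Rightarrow> real"
  assumes [measurable]: "u \<in> borel_measurable borel"
  shows "near_energy \<delta> s p u = (\<integral>\<^sup>+h. \<integral>\<^sup>+x. ennreal (\<bar>u x - u (x + h)\<bar> powr p
      / norm h powr (real DIM('a) + s * p)) * indicator {z. norm z < \<delta>} h \<partial>lborel \<partial>lborel)"
proof -
  have "near_density \<delta> s p u x = (\<integral>\<^sup>+h. ennreal (\<bar>u x - u (x + h)\<bar> powr p
      / norm h powr (real DIM('a) + s * p)) * indicator {z. norm z < \<delta>} h \<partial>lborel)" for x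
    unfolding near_density_def
    by (subst nn_integral_lborel_shift[symmetric, of _ x]) (auto simp: indicator_def)
  then have "near_energy \<delta> s p u = (\<integral>\<^sup>+x. \<integral>\<^sup>+h. ennreal (\<bar>u x - u (x + h)\<bar> powr p
      / norm h powr (real DIM('a) + s * p)) * indicator {z. norm z < \<delta>} h \<partial>lborel \<partial>lborel)"
    unfolding near_energy_def by (intro nn_integral_cong)
  also have "\<dots> = (\<integral>\<^sup>+h. \<integral>\<^sup>+x. ennreal (\<bar>u x - u (x + h)\<bar> powr p
      / norm h powr (real DIM('a) + s * p)) * indicator {z. norm z < \<delta>} h \<partial>lborel \<partial>lborel)"
    by (subst lborel_pair.Fubini') auto
  finally show ?thesis .
qed

text \<open>
Each summand is at most the \<open>p\<close>-norm of the family.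
\<close>
lemma powr_sum_le:
  fixes f :: "'i \<Rightarrow> real"
  assumes "finite J" "\<And>j. j \<in> J \<Longrightarrow> 0 \<le> f j" "0 < p"
  shows "(\<Sum>j\<in>J. f j) powr p \<le> real (card J) powr p * (\<Sum>j\<in>J. f j powr p)"
proof -
  define B where "B = (\<Sum>j\<in>J. f j powr p) powr (1 / p)"
  have "f j \<le> B" if "j \<in> J" for j
  proof -
    have "f j = (f j powr p) powr (1 / p)" using assms that by (simp add: powr_powr)
    also have "\<dots> \<le> B" unfolding B_def
      using assms that by (intro powr_mono2 member_le_sum) auto
    finally show ?thesis .
  qed
  then have "(\<Sum>j\<in>J. f j) \<le> real (card J) * B" by (rule sum_bounded_above)
  then have "(\<Sum>j\<in>J. f j) powr p \<le> (real (card J) * B) powr p"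
    using assms by (intro powr_mono2 sum_nonneg) auto
  also have "\<dots> = real (card J) powr p * (\<Sum>j\<in>J. f j powr p)"
    using assms by (simp add: B_def powr_mult powr_powr sum_nonneg)
  finally show ?thesis .
qed

text \<open>
A bound on the short-range energy bounds \<open>\<integral> \<bar>u x - u (x + h)\<bar> powr p\<close> on average over the shifts \<open>h\<close> in a
small ball \<open>H\<close> away from the origin. For \<open>x\<close> in \<open>\<Omega>\<close> and \<open>h\<close> in \<open>H\<close>, the point \<open>x + k h\<close> lies outside
\<open>\<Omega>\<close> for a fixed large \<open>k\<close>, so \<open>u x\<close> is the sum of the \<open>k\<close> increments along \<open>x, x + h, \<dots>, x + k h\<close>. By translation
invariance they all have the same \<open>L\<^sup>p\<close> norm. Averaging over \<open>H\<close> gives the claim.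
\<close>
lemma poincare:
  fixes \<Omega> :: "'a::euclidean_space set"
  assumes p: "0 < p" "0 < s" and \<Omega>: "bounded \<Omega>"
  obtains P where "0 \<le> P"
    "\<And>u. u \<in> borel_supported \<Omega> \<Longrightarrow>
       (\<integral>\<^sup>+x. ennreal (\<bar>u x\<bar> powr p) \<partial>lborel) \<le> ennreal P * near_energy (1 / 2) s p u"
proof -
  obtain b :: 'a where b: "b \<in> Basis" using nonempty_Basis by blast
  define H where "H = ball ((1 / 4) *\<^sub>R b) (1 / 16)"
  have [measurable]: "H \<in> sets borel" by (simp add: H_def)
  have H: "1 / 8 < norm h" "norm h < 1 / 2" if "h \<in> H" for h
  proof -
    have "norm ((1 / 4) *\<^sub>R b - h) < 1 / 16" using that by (simp add: H_def dist_norm)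
    moreover have "norm ((1 / 4) *\<^sub>R b) = 1 / 4" using b by simp
    ultimately show "1 / 8 < norm h" "norm h < 1 / 2"
      using norm_triangle_ineq2[of "(1 / 4) *\<^sub>R b" h] norm_triangle_ineq2[of h "(1 / 4) *\<^sub>R b"]
      by (auto simp: norm_minus_commute)
  qed
  define m where "m = measure lborel H"
  have m: "0 < m" "emeasure lborel H = ennreal m"
    by (simp_all add: m_def H_def emeasure_ball_eq_measure)
  obtain R where R: "0 < R" "\<And>x. x \<in> \<Omega> \<Longrightarrow> norm x \<le> R"
    using \<Omega> by (auto simp: bounded_pos)
  obtain k :: nat where k: "16 * R < real k" using reals_Archimedean2 by blast
  define e where "e = real DIM('a) + s * p"
  have e: "0 < e" using p by (simp add: e_def add_nonneg_pos)
  show ?thesis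
  proof (rule that[of "real k powr p * real k / m"])
    show "0 \<le> real k powr p * real k / m" using m by simp
    fix u :: "'a \<Rightarrow> real"
    assume "u \<in> borel_supported \<Omega>"
    then have [measurable]: "u \<in> borel_measurable borel" and u0: "\<forall>x. x \<notin> \<Omega> \<longrightarrow> u x = 0"
      by (auto simp: borel_supported_def)
    define D where "D h = (\<integral>\<^sup>+x. ennreal (\<bar>u x - u (x + h)\<bar> powr p) \<partial>lborel)" for h
    have [measurable]: "D \<in> borel_measurable borel" unfolding D_def by measurable
    have chain: "(\<integral>\<^sup>+x. ennreal (\<bar>u x\<bar> powr p) \<partial>lborel) \<le> ennreal (real k powr p * real k) * D h"
      if h: "h \<in> H" for h
    proof -
      let ?d = "\<lambda>j x. \<bar>u (real j *\<^sub>R h + x) - u (real j *\<^sub>R h + x + h)\<bar>"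
      have pw: "\<bar>u x\<bar> powr p \<le> real k powr p * (\<Sum>j<k. ?d j x powr p)" for x
      proof (cases "x \<in> \<Omega>")
        case True
        have "norm (real k *\<^sub>R h) = real k * norm h" by simp
        moreover have "real k * (1 / 8) \<le> real k * norm h"
          using H[OF h] by (intro mult_left_mono) auto
        ultimately have "2 * R < norm (real k *\<^sub>R h)" using k by linarith
        moreover have "norm (real k *\<^sub>R h) - norm x \<le> norm (real k *\<^sub>R h + x)"
          by (rule norm_diff_ineq)
        ultimately have "R < norm (real k *\<^sub>R h + x)" using R(2)[OF True] by linarith
        then have far: "u (real k *\<^sub>R h + x) = 0" using R(2) u0 by force
        have "(\<Sum>j<k. u (real j *\<^sub>R h + x) - u (real j *\<^sub>R h + x + h)) = u x"
          using sum_lessThan_telescope'[of "\<lambda>j. u (real j *\<^sub>R h + x)" k] far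
          by (simp add: algebra_simps)
        then have "\<bar>u x\<bar> \<le> (\<Sum>j<k. ?d j x)" by (metis sum_abs)
        then have "\<bar>u x\<bar> powr p \<le> (\<Sum>j<k. ?d j x) powr p" using p by (intro powr_mono2) auto
        also have "\<dots> \<le> real k powr p * (\<Sum>j<k. ?d j x powr p)"
          using powr_sum_le[of "{..<k}" "\<lambda>j. ?d j x" p] p by simp
        finally show ?thesis .
      next
        case False
        then show ?thesis using u0 by (simp add: sum_nonneg)
      qed
      have "(\<integral>\<^sup>+x. ennreal (\<bar>u x\<bar> powr p) \<partial>lborel)
          \<le> (\<integral>\<^sup>+x. ennreal (real k powr p) * (\<Sum>j<k. ennreal (?d j x powr p)) \<partial>lborel)"
        using pw by (intro nn_integral_mono) (simp add: ennreal_mult[symmetric] sum_nonneg)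
      also have "\<dots> = ennreal (real k powr p) * (\<Sum>j<k. \<integral>\<^sup>+x. ennreal (?d j x powr p) \<partial>lborel)"
        by (subst nn_integral_cmult) (auto simp: nn_integral_sum simp del: sum_ennreal)
      also have "\<dots> = ennreal (real k powr p) * (\<Sum>j<k. D h)"
        unfolding D_def
        by (intro arg_cong2[where f = "(*)"] refl sum.cong
              nn_integral_lborel_shift[of "\<lambda>x. ennreal (\<bar>u x - u (x + h)\<bar> powr p)"]) measurable
      finally show ?thesis by (simp add: ennreal_mult mult.assoc ennreal_of_nat_eq_real_of_nat)
    qed
    have "ennreal m * (\<integral>\<^sup>+x. ennreal (\<bar>u x\<bar> powr p) \<partial>lborel)
        = (\<integral>\<^sup>+h. (\<integral>\<^sup>+x. ennreal (\<bar>u x\<bar> powr p) \<partial>lborel) * indicator H h \<partial>lborel)"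
      by (subst nn_integral_cmult) (auto simp: m mult.commute)
    also have "\<dots> \<le> (\<integral>\<^sup>+h. ennreal (real k powr p * real k) * (\<integral>\<^sup>+x. ennreal (\<bar>u x - u (x + h)\<bar> powr p
      / norm h powr e) * indicator {z. norm z < 1 / 2} h \<partial>lborel) \<partial>lborel)"
    proof (intro nn_integral_mono)
      fix h :: 'a
      have "D h \<le> (\<integral>\<^sup>+x. ennreal (\<bar>u x - u (x + h)\<bar> powr p / norm h powr e)
          * indicator {z. norm z < 1 / 2} h \<partial>lborel)" if h: "h \<in> H"
      proof -
        \<comment> \<open>The weight \<open>1 / norm h powr e\<close> is at least \<open>1\<close> because \<open>h\<close> is shorter than \<open>1\<close>.\<close>
        have "norm h powr e \<le> 1 powr e" using H[OF h] e by (intro powr_mono2) auto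
        moreover have "0 < norm h powr e" using H[OF h] by (auto simp flip: zero_less_norm_iff)
        ultimately show ?thesis unfolding D_def using H[OF h]
          by (intro nn_integral_mono) (auto simp: field_simps intro!: ennreal_leI mult_left_le_one_le)
      qed
      then show "(\<integral>\<^sup>+x. ennreal (\<bar>u x\<bar> powr p) \<partial>lborel) * indicator H h
         \<le> ennreal (real k powr p * real k) * (\<integral>\<^sup>+x. ennreal (\<bar>u x - u (x + h)\<bar> powr p
           / norm h powr e) * indicator {z. norm z < 1 / 2} h \<partial>lborel)"
        using order_trans[OF chain mult_left_mono] by (cases "h \<in> H") auto
    qed
    also have "\<dots> = ennreal (real k powr p * real k) * near_energy (1 / 2) s p u"
      unfolding near_energy_translations[OF \<open>u \<in> borel_measurable borel\<close>] e_def
      by (subst nn_integral_cmult) auto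
    finally have "ennreal (1 / m) * (ennreal m * (\<integral>\<^sup>+x. ennreal (\<bar>u x\<bar> powr p) \<partial>lborel))
       \<le> ennreal (1 / m) * (ennreal (real k powr p * real k) * near_energy (1 / 2) s p u)"
      by (rule mult_left_mono) simp
    then show "(\<integral>\<^sup>+x. ennreal (\<bar>u x\<bar> powr p) \<partial>lborel)
        \<le> ennreal (real k powr p * real k / m) * near_energy (1 / 2) s p u"
      using m by (simp add: mult.assoc[symmetric] ennreal_mult[symmetric])
  qed
qed

section \<open>Fractional Sobolev inequality\<close>

lemma nn_integral_lim_le:
  fixes f :: "nat \<Rightarrow> 'b \<Rightarrow> ennreal"
  assumes [measurable]: "\<And>n. f n \<in> borel_measurable M"
    and lim: "AE x in M. (\<lambda>n. f n x) \<longlonglongrightarrow> g x"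
    and le: "eventually (\<lambda>n. (\<integral>\<^sup>+x. f n x \<partial>M) \<le> B) sequentially"
  shows "(\<integral>\<^sup>+x. g x \<partial>M) \<le> B"
proof -
  have "(\<integral>\<^sup>+x. g x \<partial>M) = (\<integral>\<^sup>+x. liminf (\<lambda>n. f n x) \<partial>M)"
    using lim by (intro nn_integral_cong_AE) (auto simp: lim_imp_Liminf)
  also have "\<dots> \<le> liminf (\<lambda>n. \<integral>\<^sup>+x. f n x \<partial>M)" by (rule nn_integral_liminf) measurable
  also have "\<dots> \<le> liminf (\<lambda>n. B)" by (rule Liminf_mono[OF le])
  finally show ?thesis by (simp add: Liminf_const)
qed

text \<open>
Inclusion of Lebesgue spaces on a bounded set. The estimate is made on a ball that contains \<open>\<Omega>\<close>,
whose volume is positive even if \<open>\<Omega>\<close> is a null set.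
\<close>
lemma nn_integral_powr_le_of_bounded_support:
  fixes \<Omega> :: "'a::euclidean_space set"
  assumes \<Omega>: "bounded \<Omega>" and ab: "0 < a" "a \<le> b"
  obtains A where "0 \<le> A"
    "\<And>u U. \<lbrakk>u \<in> borel_supported \<Omega>; 0 \<le> U;
        (\<integral>\<^sup>+x. ennreal (\<bar>u x\<bar> powr b) \<partial>lborel) \<le> ennreal (U powr b)\<rbrakk>
     \<Longrightarrow> (\<integral>\<^sup>+x. ennreal (\<bar>u x\<bar> powr a) \<partial>lborel) \<le> ennreal ((A * U) powr a)"
proof -
  obtain R where R: "0 < R" "\<Omega> \<subseteq> ball 0 R" using bounded_subset_ballD[OF \<Omega>] by blast
  define S where "S = (ball 0 R :: 'a set)"
  define m where "m = measure lborel S"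
  have m: "0 < m" "emeasure lborel S = ennreal m"
    using R by (simp_all add: m_def S_def emeasure_ball_eq_measure)
  define A where "A = (2 * m powr (1 - a / b)) powr (1 / a)"
  show ?thesis
  proof (rule that[of A])
    show "0 \<le> A" by (simp add: A_def)
    fix u :: "'a \<Rightarrow> real" and U :: real
    assume u: "u \<in> borel_supported \<Omega>"
      and U: "0 \<le> U" "(\<integral>\<^sup>+x. ennreal (\<bar>u x\<bar> powr b) \<partial>lborel) \<le> ennreal (U powr b)"
    have [measurable]: "u \<in> borel_measurable borel" and u0: "\<forall>x. x \<notin> \<Omega> \<longrightarrow> u x = 0"
      using u by (auto simp: borel_supported_def)
    have S: "(\<integral>\<^sup>+x. ennreal (\<bar>u x\<bar> powr c) \<partial>lborel) = (\<integral>\<^sup>+x\<in>S. ennreal (\<bar>u x\<bar> powr c) \<partial>lborel)" for c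
      using R(2) u0 by (intro nn_integral_cong) (auto simp: indicator_def S_def)
    have "(\<integral>\<^sup>+x\<in>S. ennreal (\<bar>u x\<bar> powr a) \<partial>lborel)
        \<le> ennreal (2 * m powr (1 - a / b) * (U powr b) powr (a / b))"
      by (rule nn_integral_powr_le) (use m ab U S[of b] in \<open>auto simp: S_def\<close>)
    also have "2 * m powr (1 - a / b) * (U powr b) powr (a / b) = (A * U) powr a"
      using ab U by (simp add: A_def powr_mult powr_powr)
    finally show "(\<integral>\<^sup>+x. ennreal (\<bar>u x\<bar> powr a) \<partial>lborel) \<le> ennreal ((A * U) powr a)"
      by (simp add: S)
  qed
qed

lemma integrable_of_nn_integral_powr_one:
  fixes u :: "'a::euclidean_space \<Rightarrow> real"
  assumes [measurable]: "u \<in> borel_measurable borel"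
    and le: "(\<integral>\<^sup>+x. ennreal (\<bar>u x\<bar> powr 1) \<partial>lborel) \<le> ennreal (B powr 1)" and B: "0 \<le> B"
  shows "integrable lborel u" and "(LINT x|lborel. \<bar>u x\<bar>) \<le> B"
proof -
  have le': "(\<integral>\<^sup>+x. ennreal (norm (u x)) \<partial>lborel) \<le> ennreal B" using le B by simp
  then show int: "integrable lborel u"
    by (intro integrableI_bounded) (auto intro: le_less_trans)
  have "ennreal (LINT x|lborel. norm (u x)) \<le> ennreal B"
    using le' nn_integral_eq_integral[OF integrable_norm[OF int]] by simp
  then show "(LINT x|lborel. \<bar>u x\<bar>) \<le> B" using B by simp
qed

lemma poincare_L1:
  fixes \<Omega> :: "'a::euclidean_space set"
  assumes p: "1 < p" "0 < s" and \<Omega>: "bounded \<Omega>"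
  obtains A where "0 \<le> A"
    "\<And>u X. \<lbrakk>u \<in> borel_supported \<Omega>; 0 \<le> X; near_energy (1 / 2) s p u \<le> ennreal X\<rbrakk>
       \<Longrightarrow> integrable lborel u \<and> (LINT x|lborel. \<bar>u x\<bar>) \<le> A * X powr (1 / p)"
proof -
  have p01: "0 < p" "1 \<le> p" using p by auto
  obtain P where P: "0 \<le> P"
    "\<And>u. u \<in> borel_supported \<Omega> \<Longrightarrow>
       (\<integral>\<^sup>+x. ennreal (\<bar>u x\<bar> powr p) \<partial>lborel) \<le> ennreal P * near_energy (1 / 2) s p u"
    by (rule poincare[OF p01(1) p(2) \<Omega>]) (rule that)
  obtain A where A: "0 \<le> A"
    "\<And>u U. \<lbrakk>u \<in> borel_supported \<Omega>; 0 \<le> U;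
        (\<integral>\<^sup>+x. ennreal (\<bar>u x\<bar> powr p) \<partial>lborel) \<le> ennreal (U powr p)\<rbrakk>
     \<Longrightarrow> (\<integral>\<^sup>+x. ennreal (\<bar>u x\<bar> powr 1) \<partial>lborel) \<le> ennreal ((A * U) powr 1)"
    by (rule nn_integral_powr_le_of_bounded_support[OF \<Omega> zero_less_one p01(2)]) (rule that)
  show ?thesis
  proof (rule that[of "A * P powr (1 / p)"])
    show "0 \<le> A * P powr (1 / p)" using A by simp
    fix u :: "'a \<Rightarrow> real" and X
    assume u: "u \<in> borel_supported \<Omega>"
      and X: "0 \<le> X" "near_energy (1 / 2) s p u \<le> ennreal X"
    have um: "u \<in> borel_measurable borel" using u by (simp add: borel_supported_def)
    let ?U = "(P * X) powr (1 / p)"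
    have "(\<integral>\<^sup>+x. ennreal (\<bar>u x\<bar> powr p) \<partial>lborel) \<le> ennreal P * ennreal X"
      using P(2)[OF u] mult_left_mono[OF X(2), of "ennreal P"] by (auto intro: order_trans)
    also have "\<dots> = ennreal (?U powr p)"
      using P X p by (simp add: powr_powr ennreal_mult)
    finally have "(\<integral>\<^sup>+x. ennreal (\<bar>u x\<bar> powr 1) \<partial>lborel) \<le> ennreal ((A * ?U) powr 1)"
      by (rule A(2)[OF u powr_ge_zero])
    from integrable_of_nn_integral_powr_one[OF um this] A P X
    show "integrable lborel u \<and> (LINT x|lborel. \<bar>u x\<bar>) \<le> A * P powr (1 / p) * X powr (1 / p)"
      by (simp_all add: powr_mult mult.assoc)
  qed
qed

lemma set_integral_ball_le:
  fixes u :: "'a::euclidean_space \<Rightarrow> real"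
  assumes "integrable lborel u"
  shows "\<bar>LINT y:ball z r|lborel. u y\<bar> \<le> (LINT x|lborel. \<bar>u x\<bar>)"
proof -
  have i: "integrable lborel (\<lambda>y. indicator (ball z r) y *\<^sub>R u y)"
    using assms by (intro integrable_mult_indicator) auto
  have "\<bar>LINT y:ball z r|lborel. u y\<bar> \<le> (LINT y|lborel. norm (indicator (ball z r) y *\<^sub>R u y))"
    unfolding set_lebesgue_integral_def using integral_norm_bound[of lborel] by simp
  also have "\<dots> \<le> (LINT x|lborel. norm (u x))"
    using i assms by (intro integral_mono integrable_norm) (auto simp: indicator_def)
  finally show ?thesis by simp
qed

lemma finite_ball_net:
  fixes \<Omega> :: "'a::euclidean_space set"
  assumes "bounded \<Omega>" "0 < r"
  obtains C where "finite C" "\<Omega> \<subseteq> (\<Union>c\<in>C. ball c r)"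
proof -
  have "compact (closure \<Omega>)" using assms by simp
  then obtain C where "finite C" "closure \<Omega> \<subseteq> (\<Union>c\<in>C. ball c r)"
    using assms unfolding compact_eq_totally_bounded by blast
  then show ?thesis using that closure_subset by blast
qed

text \<open>
The localized inequality at \<open>\<delta> = 1 / 2\<close>, with the finitely many averages bounded by the Poincare
inequality. It presupposes a finite \<open>L\<^sup>q\<close> norm, hence it is applied to the truncations of \<open>u\<close> at height
\<open>n\<close>, which have no larger energy. The bound is independent of \<open>n\<close>, and Fatou's lemma carries it over
to \<open>u\<close>.
\<close>
lemma fractional_sobolev:
  fixes \<Omega> :: "'a::euclidean_space set"
  assumes p: "1 < p" "0 < s" "s * p < real DIM('a)" and q: "q = critical_exponent DIM('a) s p"
    and \<Omega>: "\<Omega> \<in> sets borel" "bounded \<Omega>"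
  obtains K where "0 \<le> K"
    "\<And>u X. \<lbrakk>u \<in> borel_supported \<Omega>; 0 \<le> X; near_energy (1 / 2) s p u \<le> ennreal X\<rbrakk>
       \<Longrightarrow> (\<integral>\<^sup>+x. ennreal (\<bar>u x\<bar> powr q) \<partial>lborel) \<le> ennreal ((K * X powr (1 / p)) powr q)"
proof -
  have q0: "0 < q" using p by (simp add: q critical_exponent_def)
  obtain K where K: "0 \<le> K"
    "\<And>u \<delta> C U X. \<lbrakk>u \<in> borel_supported \<Omega>; integrable lborel u;
       (\<integral>\<^sup>+x. ennreal (\<bar>u x\<bar> powr q) \<partial>lborel) = ennreal (U powr q); 0 \<le> U;
       0 < \<delta>; finite C; \<Omega> \<subseteq> (\<Union>c\<in>C. ball c (\<delta> / 2)); near_energy \<delta> s p u \<le> ennreal X; 0 \<le> X\<rbrakk>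
     \<Longrightarrow> U \<le> K * (X powr (1 / p) + (\<Sum>c\<in>C. \<bar>ball_average u c (\<delta> / 2)\<bar>))"
    by (rule localized_sobolev[OF p q \<Omega>]) (rule that)
  obtain A where A: "0 \<le> A"
    "\<And>u X. \<lbrakk>u \<in> borel_supported \<Omega>; 0 \<le> X; near_energy (1 / 2) s p u \<le> ennreal X\<rbrakk>
       \<Longrightarrow> integrable lborel u \<and> (LINT x|lborel. \<bar>u x\<bar>) \<le> A * X powr (1 / p)"
    by (rule poincare_L1[OF p(1,2) \<Omega>(2)]) (rule that)
  obtain C where C: "finite C" "\<Omega> \<subseteq> (\<Union>c\<in>C. ball c (1 / 2 / 2))"
    using finite_ball_net[OF \<Omega>(2), of "1 / 2 / 2"] by auto
  define D where "D = (\<Sum>c\<in>C. A / measure lborel (ball c (1 / 2 / 2)))"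
  have D: "0 \<le> D" using A by (simp add: D_def sum_nonneg)
  show ?thesis
  proof (rule that[of "K * (1 + D)"])
    show "0 \<le> K * (1 + D)" using K D by simp
    fix u :: "'a \<Rightarrow> real" and X
    assume u: "u \<in> borel_supported \<Omega>"
      and X: "0 \<le> X" "near_energy (1 / 2) s p u \<le> ennreal X"
    have [measurable]: "u \<in> borel_measurable borel" and u0: "\<forall>x. x \<notin> \<Omega> \<longrightarrow> u x = 0"
      using u by (auto simp: borel_supported_def)
    define T where "T n x = max (- real n) (min (real n) (u x))" for n x
    have [measurable]: "T n \<in> borel_measurable borel" for n unfolding T_def by measurable
    have bound: "(\<integral>\<^sup>+x. ennreal (\<bar>T n x\<bar> powr q) \<partial>lborel)
        \<le> ennreal ((K * (1 + D) * X powr (1 / p)) powr q)" for n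
    proof -
      have Tn: "T n \<in> borel_supported \<Omega>" using u0 by (simp add: borel_supported_def) (simp add: T_def)
      then have T0: "\<forall>x. x \<notin> \<Omega> \<longrightarrow> T n x = 0" by (simp add: borel_supported_def)
      have "near_energy (1 / 2) s p (T n) \<le> near_energy (1 / 2) s p u"
        using p by (intro near_energy_contraction) (auto simp: T_def)
      then have TX: "near_energy (1 / 2) s p (T n) \<le> ennreal X" using X by order
      have int: "integrable lborel (T n)" "(LINT x|lborel. \<bar>T n x\<bar>) \<le> A * X powr (1 / p)"
        using A(2)[OF Tn X(1) TX] by auto
      have "(\<integral>\<^sup>+x. ennreal (\<bar>T n x\<bar> powr q) \<partial>lborel)
          \<le> (\<integral>\<^sup>+x. ennreal (real n powr q) * indicator \<Omega> x \<partial>lborel)"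
        using T0 q0 by (intro nn_integral_mono)
          (auto simp: indicator_def T_def intro!: ennreal_leI powr_mono2)
      also have "\<dots> < \<infinity>"
        using \<Omega> emeasure_bounded_finite[OF \<Omega>(2)] by (simp add: nn_integral_cmult ennreal_mult_less_top)
      finally have fin: "(\<integral>\<^sup>+x. ennreal (\<bar>T n x\<bar> powr q) \<partial>lborel) < \<infinity>" .
      define U where "U = enn2real (\<integral>\<^sup>+x. ennreal (\<bar>T n x\<bar> powr q) \<partial>lborel) powr (1 / q)"
      have U: "(\<integral>\<^sup>+x. ennreal (\<bar>T n x\<bar> powr q) \<partial>lborel) = ennreal (U powr q)" "0 \<le> U"
        using fin q0 by (auto simp: U_def powr_powr)
      have "U \<le> K * (X powr (1 / p) + (\<Sum>c\<in>C. \<bar>ball_average (T n) c (1 / 2 / 2)\<bar>))"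
        by (rule K(2)[OF Tn int(1) U _ C TX X(1)]) auto
      moreover have "(\<Sum>c\<in>C. \<bar>ball_average (T n) c (1 / 2 / 2)\<bar>) \<le> D * X powr (1 / p)"
        unfolding D_def sum_distrib_right
      proof (rule sum_mono)
        fix c
        show "\<bar>ball_average (T n) c (1 / 2 / 2)\<bar>
            \<le> A / measure lborel (ball c (1 / 2 / 2)) * X powr (1 / p)"
          using order_trans[OF set_integral_ball_le[OF int(1)] int(2)]
          by (simp add: ball_average_def divide_right_mono)
      qed
      ultimately have "U \<le> K * (X powr (1 / p) + D * X powr (1 / p))"
        using K(1) by (meson add_left_mono mult_left_mono order_trans)
      then have "U \<le> K * (1 + D) * X powr (1 / p)" by (simp add: algebra_simps)
      then have "U powr q \<le> (K * (1 + D) * X powr (1 / p)) powr q"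
        using U q0 by (intro powr_mono2) auto
      then show ?thesis unfolding U by (rule ennreal_leI)
    qed
    show "(\<integral>\<^sup>+x. ennreal (\<bar>u x\<bar> powr q) \<partial>lborel) \<le> ennreal ((K * (1 + D) * X powr (1 / p)) powr q)"
    proof (rule nn_integral_lim_le[where f = "\<lambda>n x. ennreal (\<bar>T n x\<bar> powr q)"])
      show "AE x in lborel. (\<lambda>n. ennreal (\<bar>T n x\<bar> powr q)) \<longlonglongrightarrow> ennreal (\<bar>u x\<bar> powr q)"
      proof (rule AE_I2, rule tendsto_eventually)
        fix x
        obtain n0 where "\<bar>u x\<bar> \<le> real n0" using real_arch_simple by blast
        then have "T n x = u x" if "n0 \<le> n" for n using that by (simp add: T_def)
        then show "\<forall>\<^sub>F n in sequentially. ennreal (\<bar>T n x\<bar> powr q) = ennreal (\<bar>u x\<bar> powr q)"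
          by (intro eventually_sequentiallyI[of n0]) simp
      qed
    qed (use bound in auto)
  qed
qed

section \<open>Compactness of energy-bounded sequences\<close>

lemma near_energy_le_of_slog_energy:
  fixes u :: "'a::euclidean_space \<Rightarrow> real"
  assumes "u \<in> borel_measurable borel" "0 < s" "s < 1" "0 < p" "0 < \<delta>" "\<delta> < 1"
    and E: "slog_energy s p u \<le> ennreal E"
  shows "near_energy \<delta> s p u \<le> ennreal (E / (frac_const DIM('a) s p * - ln \<delta>))"
proof -
  define c where "c = frac_const DIM('a) s p * - ln \<delta>"
  have c: "0 < c" unfolding c_def
    using frac_const_pos[of s p "DIM('a)"] assms by (intro mult_pos_pos) auto
  have "ennreal c * near_energy \<delta> s p u \<le> ennreal E"
    using near_energy_le_slog_energy[OF assms(1-6)] E unfolding c_def by order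
  then have "ennreal (1 / c) * (ennreal c * near_energy \<delta> s p u) \<le> ennreal (1 / c) * ennreal E"
    by (intro mult_left_mono) auto
  then show ?thesis using c unfolding c_def[symmetric]
    by (simp add: mult.assoc[symmetric] ennreal_mult'[symmetric])
qed

lemma ball_average_diff:
  fixes f g :: "'a::euclidean_space \<Rightarrow> real"
  assumes "integrable lborel f" "integrable lborel g"
  shows "ball_average (\<lambda>x. f x - g x) z r = ball_average f z r - ball_average g z r"
proof -
  have "set_integrable lborel (ball z r) f" "set_integrable lborel (ball z r) g"
    unfolding set_integrable_def by (intro integrable_mult_indicator assms; simp)+
  then show ?thesis by (simp add: ball_average_def set_integral_diff diff_divide_distrib)
qed

lemma borel_supported_diff:
  assumes "f \<in> borel_supported \<Omega>" "g \<in> borel_supported \<Omega>"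
  shows "(\<lambda>x. f x - g x) \<in> borel_supported \<Omega>"
  using assms by (auto simp: borel_supported_def)

text \<open>
There are countably many balls in all, and the integrals over them are bounded by \<open>B\<close>, so a diagonal
sequence works. The integrals are used instead of the averages because the latter have no bound
that is uniform in the radius.
\<close>
lemma ball_averages_convergent_subsequence:
  fixes v :: "nat \<Rightarrow> 'a::euclidean_space \<Rightarrow> real" and C :: "nat \<Rightarrow> 'a set"
  assumes C: "\<And>k. finite (C k)" and int: "\<And>n. integrable lborel (v n)"
    and B: "\<And>n. (LINT x|lborel. \<bar>v n x\<bar>) \<le> B"
  obtains \<kappa> where "strict_mono \<kappa>"
    "\<And>k c. c \<in> C k \<Longrightarrow> convergent (\<lambda>n. ball_average (v (\<kappa> n)) c (r k))"
proof -
  define F where "F n z = (LINT y:ball (fst z) (r (snd z))|lborel. v n y)" for n z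
  define Z where "Z = (\<Union>k. C k \<times> {k})"
  have "countable Z" unfolding Z_def using C by (intro countable_UN) (auto intro: countable_finite)
  moreover have "norm (F n z) \<le> B" for n z
    using order_trans[OF set_integral_ball_le[OF int] B] by (simp add: F_def)
  ultimately obtain \<kappa> where \<kappa>: "strict_mono \<kappa>" "\<And>z. z \<in> Z \<Longrightarrow> \<exists>l. (\<lambda>n. F (\<kappa> n) z) \<longlonglongrightarrow> l"
    using function_convergent_subsequence[of Z F B] by blast
  have "convergent (\<lambda>n. ball_average (v (\<kappa> n)) c (r k))" if "c \<in> C k" for c k
  proof -
    have "(c, k) \<in> Z" using that by (auto simp: Z_def)
    then obtain l where "(\<lambda>n. F (\<kappa> n) (c, k)) \<longlonglongrightarrow> l" using \<kappa> by blast
    then have "(\<lambda>n. F (\<kappa> n) (c, k) * inverse (measure lborel (ball c (r k))))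
       \<longlonglongrightarrow> l * inverse (measure lborel (ball c (r k)))"
      by (rule tendsto_mult_right)
    then show ?thesis unfolding convergent_def
      by (intro exI) (simp add: ball_average_def F_def divide_inverse)
  qed
  with \<kappa>(1) show ?thesis by (rule that)
qed

text \<open>
Completeness of \<open>L\<^sup>q\<close>. On a bounded set the sequence is also Cauchy in \<open>L\<^sup>1\<close>, hence a subsequence
converges almost everywhere, and Fatou's lemma turns the Cauchy property into convergence in \<open>L\<^sup>q\<close>.
\<close>
lemma Lp_Cauchy_convergent_subsequence:
  fixes v :: "nat \<Rightarrow> 'a::euclidean_space \<Rightarrow> real"
  assumes \<Omega>: "bounded \<Omega>" and q: "1 \<le> q" and v: "\<And>n. v n \<in> borel_supported \<Omega>"
    and int: "\<And>n. integrable lborel (v n)"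
    and fin: "\<And>n. (\<integral>\<^sup>+x. ennreal (\<bar>v n x\<bar> powr q) \<partial>lborel) < \<infinity>"
    and Cauchy: "\<And>\<epsilon>. 0 < \<epsilon> \<Longrightarrow> \<exists>N. \<forall>i\<ge>N. \<forall>j\<ge>N.
      (\<integral>\<^sup>+x. ennreal (\<bar>v i x - v j x\<bar> powr q) \<partial>lborel) \<le> ennreal (\<epsilon> powr q)"
  obtains \<rho> w where "strict_mono \<rho>" "w \<in> borel_supported \<Omega>"
    "(\<integral>\<^sup>+x. ennreal (\<bar>w x\<bar> powr q) \<partial>lborel) < \<infinity>"
    "\<And>\<epsilon>. 0 < \<epsilon> \<Longrightarrow> \<forall>\<^sub>F n in sequentially.
      (\<integral>\<^sup>+x. ennreal (\<bar>v (\<rho> n) x - w x\<bar> powr q) \<partial>lborel) \<le> ennreal (\<epsilon> powr q)"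
proof -
  have [measurable]: "v n \<in> borel_measurable borel" for n using v by (simp add: borel_supported_def)
  obtain A where A: "0 \<le> A"
    "\<And>u U. \<lbrakk>u \<in> borel_supported \<Omega>; 0 \<le> U;
        (\<integral>\<^sup>+x. ennreal (\<bar>u x\<bar> powr q) \<partial>lborel) \<le> ennreal (U powr q)\<rbrakk>
     \<Longrightarrow> (\<integral>\<^sup>+x. ennreal (\<bar>u x\<bar> powr 1) \<partial>lborel) \<le> ennreal ((A * U) powr 1)"
    by (rule nn_integral_powr_le_of_bounded_support[OF \<Omega> zero_less_one q]) (rule that)
  have "\<exists>N. \<forall>i\<ge>N. \<forall>j\<ge>N. (LINT x|lborel. norm (v i x - v j x)) < e" if e: "0 < e" for e
  proof -
    define \<epsilon> where "\<epsilon> = e / (A + 1)"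
    have \<epsilon>: "0 < \<epsilon>" "A * \<epsilon> < e" using A e by (auto simp: \<epsilon>_def field_simps)
    obtain N where N: "\<forall>i\<ge>N. \<forall>j\<ge>N.
        (\<integral>\<^sup>+x. ennreal (\<bar>v i x - v j x\<bar> powr q) \<partial>lborel) \<le> ennreal (\<epsilon> powr q)"
      using Cauchy[OF \<epsilon>(1)] by blast
    have "(LINT x|lborel. norm (v i x - v j x)) < e" if "N \<le> i" "N \<le> j" for i j
    proof -
      have "(\<integral>\<^sup>+x. ennreal (\<bar>v i x - v j x\<bar> powr 1) \<partial>lborel) \<le> ennreal ((A * \<epsilon>) powr 1)"
        using N that \<epsilon> by (intro A(2) borel_supported_diff v) auto
      then have "(LINT x|lborel. \<bar>v i x - v j x\<bar>) \<le> A * \<epsilon>"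
        using A \<epsilon> by (intro integrable_of_nn_integral_powr_one) auto
      then show ?thesis using \<epsilon> by simp
    qed
    then show ?thesis by blast
  qed
  from cauchy_L1_AE_cauchy_subseq[OF int this]
  obtain \<rho> where \<rho>: "strict_mono \<rho>" "AE x in lborel. Cauchy (\<lambda>i. v (\<rho> i) x)" by blast
  define w where "w x = lim (\<lambda>i. v (\<rho> i) x)" for x
  have [measurable]: "w \<in> borel_measurable borel" unfolding w_def by measurable
  have "w x = 0" if "x \<notin> \<Omega>" for x
  proof -
    have "(\<lambda>i. v (\<rho> i) x) = (\<lambda>i. 0)" using v that by (auto simp: borel_supported_def)
    then show ?thesis by (simp add: w_def)
  qed
  then have w: "w \<in> borel_supported \<Omega>" by (simp add: borel_supported_def)
  have lim: "AE x in lborel. (\<lambda>i. v (\<rho> i) x) \<longlonglongrightarrow> w x"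
    using \<rho>(2) by eventually_elim (simp add: w_def Cauchy_convergent_iff convergent_LIMSEQ_iff)
  have close: "\<forall>\<^sub>F n in sequentially.
      (\<integral>\<^sup>+x. ennreal (\<bar>v (\<rho> n) x - w x\<bar> powr q) \<partial>lborel) \<le> ennreal (\<epsilon> powr q)" if \<epsilon>: "0 < \<epsilon>" for \<epsilon>
  proof -
    obtain N where N: "\<forall>i\<ge>N. \<forall>j\<ge>N.
        (\<integral>\<^sup>+x. ennreal (\<bar>v i x - v j x\<bar> powr q) \<partial>lborel) \<le> ennreal (\<epsilon> powr q)"
      using Cauchy[OF \<epsilon>] by blast
    have N': "N \<le> \<rho> n" if "N \<le> n" for n using seq_suble[OF \<rho>(1), of n] that by simp
    show ?thesis
    proof (rule eventually_sequentiallyI)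
      fix n assume n: "N \<le> n"
      show "(\<integral>\<^sup>+x. ennreal (\<bar>v (\<rho> n) x - w x\<bar> powr q) \<partial>lborel) \<le> ennreal (\<epsilon> powr q)"
      proof (rule nn_integral_lim_le[where f = "\<lambda>m x. ennreal (\<bar>v (\<rho> n) x - v (\<rho> m) x\<bar> powr q)"])
        show "AE x in lborel. (\<lambda>m. ennreal (\<bar>v (\<rho> n) x - v (\<rho> m) x\<bar> powr q))
            \<longlonglongrightarrow> ennreal (\<bar>v (\<rho> n) x - w x\<bar> powr q)"
          using lim
        proof eventually_elim
          case (elim x)
          then have "(\<lambda>m. \<bar>v (\<rho> n) x - v (\<rho> m) x\<bar> powr q) \<longlonglongrightarrow> \<bar>v (\<rho> n) x - w x\<bar> powr q"
            using q by (intro tendsto_powr' tendsto_intros) auto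
          then show ?case by (rule tendsto_ennrealI)
        qed
        show "\<forall>\<^sub>F m in sequentially.
            (\<integral>\<^sup>+x. ennreal (\<bar>v (\<rho> n) x - v (\<rho> m) x\<bar> powr q) \<partial>lborel) \<le> ennreal (\<epsilon> powr q)"
          using N N' n by (intro eventually_sequentiallyI[of N]) auto
      qed measurable
    qed
  qed
  obtain n where n: "(\<integral>\<^sup>+x. ennreal (\<bar>v (\<rho> n) x - w x\<bar> powr q) \<partial>lborel) \<le> ennreal (1 powr q)"
    using close[of 1] by (auto simp: eventually_sequentially)
  have "(\<integral>\<^sup>+x. ennreal (\<bar>w x\<bar> powr q) \<partial>lborel)
      \<le> (\<integral>\<^sup>+x. ennreal (2 powr q) * (ennreal (\<bar>v (\<rho> n) x\<bar> powr q)
            + ennreal (\<bar>v (\<rho> n) x - w x\<bar> powr q)) \<partial>lborel)"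
  proof (intro nn_integral_mono)
    fix x
    have "\<bar>w x\<bar> powr q \<le> (\<bar>v (\<rho> n) x\<bar> + \<bar>v (\<rho> n) x - w x\<bar>) powr q"
      using q by (intro powr_mono2) auto
    also have "\<dots> \<le> 2 powr q * (\<bar>v (\<rho> n) x\<bar> powr q + \<bar>v (\<rho> n) x - w x\<bar> powr q)"
      using q by (intro powr_add_le) auto
    finally show "ennreal (\<bar>w x\<bar> powr q) \<le> ennreal (2 powr q) * (ennreal (\<bar>v (\<rho> n) x\<bar> powr q)
            + ennreal (\<bar>v (\<rho> n) x - w x\<bar> powr q))"
      by (simp add: ennreal_mult[symmetric] ennreal_plus[symmetric] del: ennreal_plus)
  qed
  also have "\<dots> = ennreal (2 powr q) * ((\<integral>\<^sup>+x. ennreal (\<bar>v (\<rho> n) x\<bar> powr q) \<partial>lborel)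
      + (\<integral>\<^sup>+x. ennreal (\<bar>v (\<rho> n) x - w x\<bar> powr q) \<partial>lborel))"
    by (simp add: nn_integral_cmult nn_integral_add)
  also have "\<dots> < \<infinity>"
    using fin[of "\<rho> n"] le_less_trans[OF n] by (simp add: ennreal_mult_less_top)
  finally show ?thesis using that \<rho>(1) w close by blast
qed

text \<open>
For each scale \<open>\<delta> k = 1 / (k + 2)\<close> fix a finite cover of \<open>\<Omega>\<close> by balls of radius \<open>\<delta> k / 2\<close>, and pass to a
subsequence along which all averages over these balls converge. Now apply the localized
inequality to differences of two members. Its energy term is small, uniformly in the members, once
\<open>k\<close> is large; for that \<open>k\<close>, the finitely many averages are small once the members are late in the
sequence. So the subsequence is Cauchy in \<open>L\<^sup>q\<close> at the critical exponent.
\<close>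
lemma energy_bounded_imp_convergent_subsequence:
  fixes \<Omega> :: "'a::euclidean_space set" and v :: "nat \<Rightarrow> 'a \<Rightarrow> real"
  assumes p: "1 < p" "0 < s" "s < 1" "s * p < real DIM('a)" and q: "q = critical_exponent DIM('a) s p"
    and \<Omega>: "\<Omega> \<in> sets borel" "bounded \<Omega>"
    and v: "\<And>n. v n \<in> borel_supported \<Omega>" and E: "\<And>n. slog_energy s p (v n) \<le> ennreal E" "0 \<le> E"
  obtains r w where "strict_mono r" "w \<in> borel_supported \<Omega>"
    "(\<integral>\<^sup>+x. ennreal (\<bar>w x\<bar> powr q) \<partial>lborel) < \<infinity>"
    "\<And>\<epsilon>. 0 < \<epsilon> \<Longrightarrow> \<forall>\<^sub>F n in sequentially.
      (\<integral>\<^sup>+x. ennreal (\<bar>v (r n) x - w x\<bar> powr q) \<partial>lborel) \<le> ennreal (\<epsilon> powr q)"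
proof -
  have vm: "v n \<in> borel_measurable borel" for n using v by (simp add: borel_supported_def)
  have "1 * (real DIM('a) - s * p) \<le> p * real DIM('a)"
    using p by (intro mult_mono) auto
  then have q1: "1 \<le> q" using p by (simp add: q critical_exponent_def mult.commute)
  define \<delta> where "\<delta> k = 1 / (real k + 2)" for k
  have \<delta>: "0 < \<delta> k" "\<delta> k < 1" for k by (auto simp: \<delta>_def)
  define Y where "Y k = E / (frac_const DIM('a) s p * - ln (\<delta> k))" for k
  define X where "X k = 2 powr p * (Y k + Y k)" for k
  have c: "0 < frac_const DIM('a) s p" using p by (intro frac_const_pos) auto
  have Y0: "0 \<le> Y k" for k
    using E c \<delta>[of k] unfolding Y_def by (intro divide_nonneg_nonneg mult_nonneg_nonneg) auto
  then have X0: "0 \<le> X k" for k by (simp add: X_def)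
  have vY: "near_energy (\<delta> k) s p (v n) \<le> ennreal (Y k)" for k n
    unfolding Y_def using p \<delta> vm E by (intro near_energy_le_of_slog_energy) auto
  have diff: "near_energy (\<delta> k) s p (\<lambda>x. v i x - v j x) \<le> ennreal (X k)" for i j k
  proof -
    have "near_energy (\<delta> k) s p (\<lambda>x. v i x - v j x)
        \<le> ennreal (2 powr p) * (near_energy (\<delta> k) s p (v i) + near_energy (\<delta> k) s p (v j))"
      using p vm by (intro near_energy_diff_le) auto
    also have "\<dots> \<le> ennreal (2 powr p) * (ennreal (Y k) + ennreal (Y k))"
      by (intro mult_left_mono add_mono vY) auto
    also have "\<dots> = ennreal (X k)"
      using Y0 by (simp add: X_def ennreal_mult[symmetric] ennreal_plus[symmetric] del: ennreal_plus)
    finally show ?thesis .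
  qed
  have "Y \<longlonglongrightarrow> 0"
  proof -
    have "filterlim (\<lambda>k. ln (real k + 2)) at_top sequentially" by real_asymp
    then have "filterlim (\<lambda>k. frac_const DIM('a) s p * ln (real k + 2)) at_top sequentially"
      using c by (intro filterlim_tendsto_pos_mult_at_top[OF tendsto_const])
    then have "(\<lambda>k. E / (frac_const DIM('a) s p * ln (real k + 2))) \<longlonglongrightarrow> 0"
      by (intro tendsto_divide_0[OF tendsto_const] filterlim_at_top_imp_at_infinity)
    then show ?thesis unfolding Y_def \<delta>_def by (simp add: ln_div)
  qed
  then have "(\<lambda>k. 2 powr p * (Y k + Y k)) \<longlonglongrightarrow> 2 powr p * (0 + 0)" by (intro tendsto_intros)
  then have X_lim: "X \<longlonglongrightarrow> 0" unfolding X_def[abs_def] by simp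
  obtain A where A: "0 \<le> A"
    "\<And>u X. \<lbrakk>u \<in> borel_supported \<Omega>; 0 \<le> X; near_energy (1 / 2) s p u \<le> ennreal X\<rbrakk>
       \<Longrightarrow> integrable lborel u \<and> (LINT x|lborel. \<bar>u x\<bar>) \<le> A * X powr (1 / p)"
    by (rule poincare_L1[OF p(1,2) \<Omega>(2)]) (rule that)
  obtain K\<^sub>S where KS: "0 \<le> K\<^sub>S"
    "\<And>u X. \<lbrakk>u \<in> borel_supported \<Omega>; 0 \<le> X; near_energy (1 / 2) s p u \<le> ennreal X\<rbrakk>
       \<Longrightarrow> (\<integral>\<^sup>+x. ennreal (\<bar>u x\<bar> powr q) \<partial>lborel) \<le> ennreal ((K\<^sub>S * X powr (1 / p)) powr q)"
    by (rule fractional_sobolev[OF p(1,2,4) q \<Omega>]) (rule that)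
  obtain K where K: "0 \<le> K"
    "\<And>u \<delta> C U X. \<lbrakk>u \<in> borel_supported \<Omega>; integrable lborel u;
       (\<integral>\<^sup>+x. ennreal (\<bar>u x\<bar> powr q) \<partial>lborel) = ennreal (U powr q); 0 \<le> U;
       0 < \<delta>; finite C; \<Omega> \<subseteq> (\<Union>c\<in>C. ball c (\<delta> / 2)); near_energy \<delta> s p u \<le> ennreal X; 0 \<le> X\<rbrakk>
     \<Longrightarrow> U \<le> K * (X powr (1 / p) + (\<Sum>c\<in>C. \<bar>ball_average u c (\<delta> / 2)\<bar>))"
    by (rule localized_sobolev[OF p(1,2,4) q \<Omega>]) (rule that)
  have d0: "\<delta> 0 = 1 / 2" by (simp add: \<delta>_def)
  have int: "integrable lborel (v n)" "(LINT x|lborel. \<bar>v n x\<bar>) \<le> A * Y 0 powr (1 / p)" for n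
    using A(2)[OF v Y0] vY[of 0] by (auto simp: d0)
  have fin: "(\<integral>\<^sup>+x. ennreal (\<bar>u x\<bar> powr q) \<partial>lborel) < \<infinity>"
    if "u \<in> borel_supported \<Omega>" "near_energy (\<delta> 0) s p u \<le> ennreal Z" "0 \<le> Z" for u Z
    using le_less_trans[OF KS(2) ennreal_less_top] that by (auto simp: d0)
  have finv: "(\<integral>\<^sup>+x. ennreal (\<bar>v n x\<bar> powr q) \<partial>lborel) < \<infinity>" for n
    by (rule fin[OF v vY Y0])
  have find: "(\<integral>\<^sup>+x. ennreal (\<bar>v i x - v j x\<bar> powr q) \<partial>lborel) < \<infinity>" for i j
    by (rule fin[OF borel_supported_diff[OF v v] diff X0])
  have "\<forall>k. \<exists>C. finite C \<and> \<Omega> \<subseteq> (\<Union>c\<in>C. ball c (\<delta> k / 2))"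
  proof
    fix k
    have "0 < \<delta> k / 2" using \<delta> by simp
    then obtain C where "finite C" "\<Omega> \<subseteq> (\<Union>c\<in>C. ball c (\<delta> k / 2))"
      by (rule finite_ball_net[OF \<Omega>(2)])
    then show "\<exists>C. finite C \<and> \<Omega> \<subseteq> (\<Union>c\<in>C. ball c (\<delta> k / 2))" by blast
  qed
  from choice[OF this] obtain C where C: "\<And>k. finite (C k)" "\<And>k. \<Omega> \<subseteq> (\<Union>c\<in>C k. ball c (\<delta> k / 2))"
    by blast
  obtain \<kappa> where \<kappa>: "strict_mono \<kappa>"
    "\<And>k c. c \<in> C k \<Longrightarrow> convergent (\<lambda>n. ball_average (v (\<kappa> n)) c (\<delta> k / 2))"
    by (rule ball_averages_convergent_subsequence
          [where v = v and C = C and r = "\<lambda>k. \<delta> k / 2", OF C(1) int]) (rule that)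
  have Cauchy: "\<exists>N. \<forall>i\<ge>N. \<forall>j\<ge>N. (\<integral>\<^sup>+x. ennreal (\<bar>v (\<kappa> i) x - v (\<kappa> j) x\<bar> powr q) \<partial>lborel)
      \<le> ennreal (\<epsilon> powr q)" if \<epsilon>: "0 < \<epsilon>" for \<epsilon>
  proof -
    \<comment> \<open>One third of \<open>d\<close> is spent on the energy term and one on the averages of each of the two
      members; \<open>K\<close> may be \<open>0\<close>, hence the denominator \<open>K + 1\<close>.\<close>
    define d where "d = \<epsilon> / (K + 1)"
    have d: "0 < d" "K * d \<le> \<epsilon>" using \<epsilon> K(1) by (simp_all add: d_def field_simps)
    define \<eta> where "\<eta> = d / 3"
    have "\<eta> + (\<eta> + \<eta>) = d" by (simp add: \<eta>_def)
    then have \<eta>: "0 < \<eta>" "K * (\<eta> + (\<eta> + \<eta>)) \<le> \<epsilon>" using d by (simp_all add: \<eta>_def)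
    have "(\<lambda>k. X k powr (1 / p)) \<longlonglongrightarrow> 0"
      using X_lim X0 p by (intro tendsto_zero_powrI[OF _ tendsto_const]) auto
    from order_tendstoD(2)[OF this \<eta>(1)] obtain k where k: "X k powr (1 / p) < \<eta>"
      by (auto simp: eventually_sequentially)
    define l where "l c = lim (\<lambda>n. ball_average (v (\<kappa> n)) c (\<delta> k / 2))" for c
    define h where "h n = (\<Sum>c\<in>C k. \<bar>ball_average (v (\<kappa> n)) c (\<delta> k / 2) - l c\<bar>)" for n
    have "h \<longlonglongrightarrow> 0" unfolding h_def
    proof (intro tendsto_null_sum tendsto_rabs_zero)
      fix c assume "c \<in> C k"
      from \<kappa>(2)[OF this] have "(\<lambda>n. ball_average (v (\<kappa> n)) c (\<delta> k / 2)) \<longlonglongrightarrow> l c"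
        by (simp add: l_def convergent_LIMSEQ_iff)
      then show "(\<lambda>n. ball_average (v (\<kappa> n)) c (\<delta> k / 2) - l c) \<longlonglongrightarrow> 0" by (rule LIM_zero)
    qed
    from order_tendstoD(2)[OF this \<eta>(1)] obtain N where N: "\<And>n. N \<le> n \<Longrightarrow> h n < \<eta>"
      by (auto simp: eventually_sequentially)
    have "(\<integral>\<^sup>+x. ennreal (\<bar>v (\<kappa> i) x - v (\<kappa> j) x\<bar> powr q) \<partial>lborel) \<le> ennreal (\<epsilon> powr q)"
      if ij: "N \<le> i" "N \<le> j" for i j
    proof -
      define U where "U = enn2real (\<integral>\<^sup>+x. ennreal (\<bar>v (\<kappa> i) x - v (\<kappa> j) x\<bar> powr q) \<partial>lborel) powr (1 / q)"
      have U: "(\<integral>\<^sup>+x. ennreal (\<bar>v (\<kappa> i) x - v (\<kappa> j) x\<bar> powr q) \<partial>lborel) = ennreal (U powr q)" "0 \<le> U"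
        using find q1 by (auto simp: U_def powr_powr)
      have "U \<le> K * (X k powr (1 / p)
          + (\<Sum>c\<in>C k. \<bar>ball_average (\<lambda>x. v (\<kappa> i) x - v (\<kappa> j) x) c (\<delta> k / 2)\<bar>))"
        by (rule K(2)[OF borel_supported_diff[OF v v] Bochner_Integration.integrable_diff[OF int(1) int(1)]
              U \<delta>(1) C diff X0])
      moreover have "(\<Sum>c\<in>C k. \<bar>ball_average (\<lambda>x. v (\<kappa> i) x - v (\<kappa> j) x) c (\<delta> k / 2)\<bar>) \<le> h i + h j"
        unfolding h_def sum.distrib[symmetric] ball_average_diff[OF int(1) int(1)]
        by (intro sum_mono) linarith
      ultimately have "U \<le> K * (\<eta> + (\<eta> + \<eta>))"
        using K(1) N[OF ij(1)] N[OF ij(2)] k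
        by (smt (verit) mult_left_mono)
      then have "U powr q \<le> \<epsilon> powr q" using \<eta> U q1 by (intro powr_mono2) auto
      then show ?thesis unfolding U by (rule ennreal_leI)
    qed
    then show ?thesis by blast
  qed
  obtain \<rho> w where \<rho>: "strict_mono \<rho>" "w \<in> borel_supported \<Omega>"
    "(\<integral>\<^sup>+x. ennreal (\<bar>w x\<bar> powr q) \<partial>lborel) < \<infinity>"
    "\<And>\<epsilon>. 0 < \<epsilon> \<Longrightarrow> \<forall>\<^sub>F n in sequentially.
      (\<integral>\<^sup>+x. ennreal (\<bar>v (\<kappa> (\<rho> n)) x - w x\<bar> powr q) \<partial>lborel) \<le> ennreal (\<epsilon> powr q)"
    by (rule Lp_Cauchy_convergent_subsequence
          [where v = "\<lambda>n. v (\<kappa> n)", OF \<Omega>(2) q1 v int(1) finv Cauchy])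
       (assumption, rule that)
  show ?thesis
    by (rule that[of "\<kappa> \<circ> \<rho>" w]) (use \<rho> strict_mono_o[OF \<kappa>(1) \<rho>(1)] in auto)
qed

section \<open>Borel representatives and the embeddings\<close>

lemma slog_energy_cong_AE:
  fixes u v :: "'a::euclidean_space \<Rightarrow> real"
  assumes "AE x in lborel. u x = v x"
  shows "slog_energy s p u = slog_energy s p v"
proof -
  obtain N where N: "N \<in> null_sets lborel" "{x. u x \<noteq> v x} \<subseteq> N"
    using assms unfolding eventually_ae_filter by auto
  have "N \<times> UNIV \<in> null_sets (lborel \<Otimes>\<^sub>M (lborel :: 'a measure))"
       "UNIV \<times> N \<in> null_sets ((lborel :: 'a measure) \<Otimes>\<^sub>M lborel)"
    using N by (auto intro: lborel.times_in_null_sets1 lborel.times_in_null_sets2)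
  then have "N \<times> UNIV \<union> UNIV \<times> N \<in> null_sets (lborel :: ('a \<times> 'a) measure)"
    unfolding lborel_prod by (rule null_sets.Un)
  then have "AE z in (lborel :: ('a \<times> 'a) measure). u (fst z) = v (fst z) \<and> u (snd z) = v (snd z)"
    by (rule AE_I') (use N in force)
  then show ?thesis
    unfolding slog_energy_def nn_integral_completion
    by (intro nn_integral_cong_AE) (auto simp: case_prod_unfold)
qed

lemma slog_space_borel_representative:
  fixes \<Omega> :: "'a::euclidean_space set"
  assumes u: "u \<in> slog_space s p \<Omega>" and \<Omega>: "\<Omega> \<in> sets borel"
  obtains v where "v \<in> borel_supported \<Omega>" "AE x in lebesgue. u x = v x"
    "slog_energy s p v = slog_energy s p u"
proof -
  have "u \<in> borel_measurable lebesgue" and u0: "AE x in lborel. x \<notin> \<Omega> \<longrightarrow> u x = 0"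
    using u by (auto simp: slog_space_def Lp_space_def AE_completion_iff)
  then obtain g where g: "g \<in> borel_measurable lborel" "AE x in lborel. u x = g x"
    using completion_ex_borel_measurable_real by blast
  define v where "v x = indicator \<Omega> x * g x" for x
  have [measurable]: "g \<in> borel_measurable borel" "\<Omega> \<in> sets borel" using g \<Omega> by auto
  have "v \<in> borel_supported \<Omega>" unfolding borel_supported_def v_def by simp
  moreover have uv: "AE x in lborel. u x = v x"
    using g(2) u0 by eventually_elim (auto simp: v_def indicator_def)
  ultimately show ?thesis
    using slog_energy_cong_AE[OF uv] by (intro that[of v]) (auto simp: AE_completion_iff)
qed

text \<open>
Transfers bounds on the representative, integrated over the whole space, to the space
\<open>L\<^sup>q(\<Omega>)\<close> over the completed measure.
\<close>
lemma Lp_norm_le_of_representative: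
  fixes \<Omega> :: "'a::euclidean_space set"
  assumes \<Omega>: "\<Omega> \<in> sets borel" and v: "v \<in> borel_supported \<Omega>"
    and u: "u \<in> borel_measurable lebesgue" "AE x in lebesgue. u x = v x" and q: "0 < q" and B: "0 \<le> B"
    and le: "(\<integral>\<^sup>+x. ennreal (\<bar>v x\<bar> powr q) \<partial>lborel) \<le> ennreal (B powr q)"
  shows "u \<in> Lp_space (lebesgue_on \<Omega>) q" "Lp_norm (lebesgue_on \<Omega>) q u \<le> B"
proof -
  have \<Omega>': "\<Omega> \<inter> space lebesgue \<in> sets lebesgue" using \<Omega> by auto
  have um: "u \<in> borel_measurable (lebesgue_on \<Omega>)" using u(1) by (rule measurable_restrict_space1)
  have "(\<integral>\<^sup>+x. ennreal (\<bar>u x\<bar> powr q) \<partial>lebesgue_on \<Omega>)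
      = (\<integral>\<^sup>+x. ennreal (\<bar>u x\<bar> powr q) * indicator \<Omega> x \<partial>lebesgue)"
    by (rule nn_integral_restrict_space[OF \<Omega>'])
  also have "\<dots> = (\<integral>\<^sup>+x. ennreal (\<bar>v x\<bar> powr q) \<partial>lebesgue)"
    using u(2) v by (intro nn_integral_cong_AE)
      (auto simp: borel_supported_def indicator_def elim!: eventually_mono)
  also have "\<dots> \<le> ennreal (B powr q)" using le by (simp add: nn_integral_completion)
  finally have le': "(\<integral>\<^sup>+x. ennreal (\<bar>u x\<bar> powr q) \<partial>lebesgue_on \<Omega>) \<le> ennreal (B powr q)" .
  have int: "integrable (lebesgue_on \<Omega>) (\<lambda>x. \<bar>u x\<bar> powr q)"
    using um le' by (intro integrableI_bounded) (auto intro: le_less_trans)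
  show "u \<in> Lp_space (lebesgue_on \<Omega>) q" using um int by (simp add: Lp_space_def)
  have "(\<integral>x. \<bar>u x\<bar> powr q \<partial>lebesgue_on \<Omega>) \<le> B powr q"
    using le' nn_integral_eq_integral[OF int] by simp
  then have "Lp_norm (lebesgue_on \<Omega>) q u \<le> (B powr q) powr (1 / q)"
    unfolding Lp_norm_def using q by (intro powr_mono2) auto
  then show "Lp_norm (lebesgue_on \<Omega>) q u \<le> B" using q B by (simp add: powr_powr)
qed

lemma slog_continuously_embedded:
  fixes \<Omega> :: "'a::euclidean_space set"
  assumes p: "1 < p" "0 < s" "s < 1" "s * p < real DIM('a)"
    and q: "1 \<le> q" "q \<le> critical_exponent DIM('a) s p"
    and \<Omega>: "\<Omega> \<in> sets borel" "bounded \<Omega>"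
  shows "continuously_embedded (slog_space s p \<Omega>) (slog_norm s p)
           (Lp_space (lebesgue_on \<Omega>) q) (Lp_norm (lebesgue_on \<Omega>) q)"
proof -
  obtain K where K: "0 \<le> K"
    "\<And>u X. \<lbrakk>u \<in> borel_supported \<Omega>; 0 \<le> X; near_energy (1 / 2) s p u \<le> ennreal X\<rbrakk>
       \<Longrightarrow> (\<integral>\<^sup>+x. ennreal (\<bar>u x\<bar> powr critical_exponent DIM('a) s p) \<partial>lborel)
         \<le> ennreal ((K * X powr (1 / p)) powr critical_exponent DIM('a) s p)"
    by (rule fractional_sobolev[OF p(1,2,4) refl \<Omega>]) (rule that)
  have q0: "0 < q" using q by simp
  obtain A where A: "0 \<le> A"
    "\<And>u U. \<lbrakk>u \<in> borel_supported \<Omega>; 0 \<le> U;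
        (\<integral>\<^sup>+x. ennreal (\<bar>u x\<bar> powr critical_exponent DIM('a) s p) \<partial>lborel)
          \<le> ennreal (U powr critical_exponent DIM('a) s p)\<rbrakk>
     \<Longrightarrow> (\<integral>\<^sup>+x. ennreal (\<bar>u x\<bar> powr q) \<partial>lborel) \<le> ennreal ((A * U) powr q)"
    by (rule nn_integral_powr_le_of_bounded_support[OF \<Omega>(2) q0 q(2)]) (rule that)
  define c where "c = frac_const DIM('a) s p * - ln (1 / 2)"
  have c: "0 < c" unfolding c_def
    using frac_const_pos[of s p "DIM('a)"] p by (intro mult_pos_pos) auto
  have main: "u \<in> Lp_space (lebesgue_on \<Omega>) q
      \<and> Lp_norm (lebesgue_on \<Omega>) q u \<le> A * K * (1 / c) powr (1 / p) * slog_norm s p u"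
    if u: "u \<in> slog_space s p \<Omega>" for u
  proof -
    obtain v where v: "v \<in> borel_supported \<Omega>" "AE x in lebesgue. u x = v x"
        "slog_energy s p v = slog_energy s p u"
      by (rule slog_space_borel_representative[OF u \<Omega>(1)])
    define E where "E = enn2real (slog_energy s p u)"
    have E: "slog_energy s p v \<le> ennreal E" "0 \<le> E"
      using u v(3) by (auto simp: E_def slog_space_def)
    have "near_energy (1 / 2) s p v \<le> ennreal (E / c)"
      unfolding c_def using v p E by (intro near_energy_le_of_slog_energy) (auto simp: borel_supported_def)
    then have le: "(\<integral>\<^sup>+x. ennreal (\<bar>v x\<bar> powr q) \<partial>lborel)
        \<le> ennreal ((A * (K * (E / c) powr (1 / p))) powr q)"
      using v K E c by (intro A(2) K(2)) auto
    have um: "u \<in> borel_measurable lebesgue" using u by (simp add: slog_space_def Lp_space_def)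
    have nonneg: "0 \<le> A * (K * (E / c) powr (1 / p))" using A(1) K(1) by simp
    have "u \<in> Lp_space (lebesgue_on \<Omega>) q
        \<and> Lp_norm (lebesgue_on \<Omega>) q u \<le> A * (K * (E / c) powr (1 / p))"
      using Lp_norm_le_of_representative[OF \<Omega>(1) v(1) um v(2) q0 nonneg le] by blast
    moreover have "(E / c) powr (1 / p) = (1 / c) powr (1 / p) * slog_norm s p u"
      using E c by (simp add: slog_norm_def powr_divide flip: E_def)
    ultimately show ?thesis by (simp add: mult.assoc)
  qed
  then show ?thesis unfolding continuously_embedded_def by blast
qed

text \<open>
For exponents below the critical one, both embeddings follow from the critical case because \<open>\<Omega>\<close> is
bounded.
\<close>
theorem theorem4p1:
  fixes \<Omega> :: "'a::euclidean_space set" and s p q :: real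
  assumes "1 < p" and "0 < s" and "s < 1" and "s * p < real DIM('a)"
    and "bounded \<Omega>" and "lipschitz_domain \<Omega>"
    and "1 \<le> q" and "q \<le> critical_exponent DIM('a) s p"
  shows "continuously_embedded (slog_space s p \<Omega>) (slog_norm s p)
           (Lp_space (lebesgue_on \<Omega>) q) (Lp_norm (lebesgue_on \<Omega>) q)
       \<and> compactly_embedded (slog_space s p \<Omega>) (slog_norm s p)
           (Lp_space (lebesgue_on \<Omega>) q) (Lp_norm (lebesgue_on \<Omega>) q)"
proof -
  have \<Omega>: "\<Omega> \<in> sets borel" using assms(6) by (simp add: lipschitz_domain_def)
  have cont: "continuously_embedded (slog_space s p \<Omega>) (slog_norm s p)
      (Lp_space (lebesgue_on \<Omega>) q) (Lp_norm (lebesgue_on \<Omega>) q)"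
    by (rule slog_continuously_embedded) (use assms \<Omega> in auto)
  let ?q = "critical_exponent DIM('a) s p"
  have q0: "0 < q" using assms by simp
  have q0': "0 < ?q" using assms by linarith
  obtain A where A: "0 \<le> A"
    "\<And>u U. \<lbrakk>u \<in> borel_supported \<Omega>; 0 \<le> U;
        (\<integral>\<^sup>+x. ennreal (\<bar>u x\<bar> powr ?q) \<partial>lborel) \<le> ennreal (U powr ?q)\<rbrakk>
     \<Longrightarrow> (\<integral>\<^sup>+x. ennreal (\<bar>u x\<bar> powr q) \<partial>lborel) \<le> ennreal ((A * U) powr q)"
    by (rule nn_integral_powr_le_of_bounded_support[OF assms(5) q0 assms(8)]) (rule that)
  have "\<exists>r w. strict_mono r \<and> w \<in> Lp_space (lebesgue_on \<Omega>) q
      \<and> (\<lambda>n. Lp_norm (lebesgue_on \<Omega>) q (\<lambda>x. u (r n) x - w x)) \<longlonglongrightarrow> 0"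
    if u: "\<And>n. u n \<in> slog_space s p \<Omega>" and B: "\<And>n. slog_norm s p (u n) \<le> B" for u :: "nat \<Rightarrow> 'a \<Rightarrow> real" and B
  proof -
    have um: "u n \<in> borel_measurable lebesgue" for n
      using u by (simp add: slog_space_def Lp_space_def)
    have "\<exists>v. v \<in> borel_supported \<Omega> \<and> (AE x in lebesgue. u n x = v x)
        \<and> slog_energy s p v = slog_energy s p (u n)" for n
      using slog_space_borel_representative[OF u \<Omega>] by metis
    then obtain v where v: "\<And>n. v n \<in> borel_supported \<Omega>" "\<And>n. AE x in lebesgue. u n x = v n x"
      "\<And>n. slog_energy s p (v n) = slog_energy s p (u n)" by metis
    have E: "slog_energy s p (v n) \<le> ennreal (B powr p)" for n
    proof -
      define e where "e = enn2real (slog_energy s p (u n))"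
      have e: "slog_energy s p (u n) = ennreal e" "0 \<le> e"
        using u[of n] by (auto simp: e_def slog_space_def)
      have "(e powr (1 / p)) powr p \<le> B powr p"
        using B[of n] assms(1) by (intro powr_mono2) (auto simp: slog_norm_def e_def)
      then show ?thesis using e assms(1) by (simp add: v powr_powr ennreal_leI)
    qed
    obtain r w where rw: "strict_mono r" "w \<in> borel_supported \<Omega>"
      "(\<integral>\<^sup>+x. ennreal (\<bar>w x\<bar> powr ?q) \<partial>lborel) < \<infinity>"
      "\<And>\<epsilon>. 0 < \<epsilon> \<Longrightarrow> \<forall>\<^sub>F n in sequentially.
        (\<integral>\<^sup>+x. ennreal (\<bar>v (r n) x - w x\<bar> powr ?q) \<partial>lborel) \<le> ennreal (\<epsilon> powr ?q)"
      by (rule energy_bounded_imp_convergent_subsequence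
            [where v = v, OF assms(1-4) refl \<Omega> assms(5) v(1) E powr_ge_zero]) (rule that)
    have wm: "w \<in> borel_measurable lebesgue"
      using rw(2) by (simp add: borel_supported_def measurable_completion)
    define W where "W = enn2real (\<integral>\<^sup>+x. ennreal (\<bar>w x\<bar> powr ?q) \<partial>lborel) powr (1 / ?q)"
    have "(\<integral>\<^sup>+x. ennreal (\<bar>w x\<bar> powr ?q) \<partial>lborel) \<le> ennreal (W powr ?q)" "0 \<le> W"
      using rw(3) q0' by (auto simp: W_def powr_powr)
    then have "(\<integral>\<^sup>+x. ennreal (\<bar>w x\<bar> powr q) \<partial>lborel) \<le> ennreal ((A * W) powr q)" "0 \<le> A * W"
      using A rw(2) by auto
    then have wL: "w \<in> Lp_space (lebesgue_on \<Omega>) q"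
      using Lp_norm_le_of_representative(1)[OF \<Omega> rw(2) wm _ q0, of "A * W"] by auto
    have "(\<lambda>n. Lp_norm (lebesgue_on \<Omega>) q (\<lambda>x. u (r n) x - w x)) \<longlonglongrightarrow> 0"
    proof (rule order_tendstoI)
      fix e :: real assume "e < 0"
      then show "\<forall>\<^sub>F n in sequentially. e < Lp_norm (lebesgue_on \<Omega>) q (\<lambda>x. u (r n) x - w x)"
        by (intro always_eventually allI) (simp add: Lp_norm_def less_le_trans)
    next
      fix e :: real assume e: "0 < e"
      define \<epsilon> where "\<epsilon> = e / (A + 1)"
      have \<epsilon>: "0 < \<epsilon>" "A * \<epsilon> < e" using A e by (auto simp: \<epsilon>_def field_simps)
      show "\<forall>\<^sub>F n in sequentially. Lp_norm (lebesgue_on \<Omega>) q (\<lambda>x. u (r n) x - w x) < e"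
        using rw(4)[OF \<epsilon>(1)]
      proof eventually_elim
        case (elim n)
        have d: "(\<lambda>x. v (r n) x - w x) \<in> borel_supported \<Omega>" by (intro borel_supported_diff v rw)
        have ae: "AE x in lebesgue. u (r n) x - w x = v (r n) x - w x"
          using v(2)[of "r n"] by eventually_elim simp
        have "(\<integral>\<^sup>+x. ennreal (\<bar>v (r n) x - w x\<bar> powr q) \<partial>lborel) \<le> ennreal ((A * \<epsilon>) powr q)"
          using A(2)[OF d _ elim] \<epsilon> by simp
        then have "Lp_norm (lebesgue_on \<Omega>) q (\<lambda>x. u (r n) x - w x) \<le> A * \<epsilon>"
          using um wm A \<epsilon> by (intro Lp_norm_le_of_representative(2)[OF \<Omega> d _ ae q0]) auto
        then show ?case using \<epsilon> by simp
      qed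
    qed
    then show ?thesis using rw(1) wL by blast
  qed
  then show ?thesis using cont unfolding compactly_embedded_def by blast
qed

end
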